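(* Let $n\ge2$, $\beta>0$, $1<\alpha<1+n\beta$, let $f$ be a smooth positive function on $S^n$ and let $c>0$ be a constant. Then the solution of $$f\,u^{\alpha-1}\,\sigma_n[\nabla^2u+uI]^{-\beta}=c\quad\text{on }S^n$$ is unique: if $u_1,u_2$ are two smooth solutions, then $u_1\equiv u_2$.
   Context: $S^n\subset\mathbb{R}^{n+1}$ is the unit sphere with its standard metric and Levi-Civita connection $\nabla$; $\sigma_n[\nabla^2u+uI]$ is the determinant of $\nabla^2u+uI$ in a local orthonormal frame. A smooth solution means a smooth positive function $u$ on $S^n$ with $\nabla^2u+uI$ positive definite, i.e. the support function of a smooth closed uniformly convex hypersurface enclosing the origin. *)

theory Defs
  imports "HOL-Analysis.Analysis" "Jordan_Normal_Form.Determinant"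
begin

section \<open>Smooth functions\<close>

primrec C_k_on :: "nat \<Rightarrow> ('a::real_normed_vector \<Rightarrow> 'b::real_normed_vector) \<Rightarrow> 'a set \<Rightarrow> bool" where
  "C_k_on 0 f U \<longleftrightarrow> continuous_on U f"
| "C_k_on (Suc k) f U \<longleftrightarrow> (\<forall>x\<in>U. f differentiable (at x)) \<and>
     (\<forall>v. C_k_on k (\<lambda>x. frechet_derivative f (at x) v) U)"

text \<open>A function on a subset of Euclidean space (here, an embedded submanifold) is smooth if near
  each point of the subset it is the restriction of a smooth function on an open set of the
  ambient space. Values outside the subset are irrelevant.\<close>

definition smooth_on :: "('a::real_normed_vector \<Rightarrow> 'b::real_normed_vector) \<Rightarrow> 'a set \<Rightarrow> bool" where
  "smooth_on f S \<longleftrightarrow> (\<forall>x\<in>S. \<exists>U F. open U \<and> x \<in> U \<and> (\<forall>k. C_k_on k F U) \<and> (\<forall>y\<in>S \<inter> U. F y = f y))"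

section \<open>The unit sphere as a Riemannian manifold\<close>

text \<open>The sphere \<open>sphere 0 1\<close> carries the metric induced by the inner product. Functions and vector
  fields on it are functions on the ambient space of which only the values on the sphere matter.\<close>

definition tangent_space :: "'a::euclidean_space \<Rightarrow> 'a set" where
  "tangent_space x = {v. v \<bullet> x = 0}"

text \<open>Derivative at \<open>x\<close> on the sphere, in direction \<open>v\<close> tangent at \<open>x\<close>, of a function given on the
  sphere. The function is extended to the punctured space by composition with the retraction
  \<open>y \<mapsto> y / norm y\<close>; the derivative of the retraction at \<open>x\<close> is the identity on tangent vectors.\<close>

definition sphere_deriv :: "('a::euclidean_space \<Rightarrow> 'b::real_normed_vector) \<Rightarrow> 'a \<Rightarrow> 'a \<Rightarrow> 'b" where
  "sphere_deriv g x v = frechet_derivative (\<lambda>y. g (y /\<^sub>R norm y)) (at x) v"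

definition sphere_grad :: "('a::euclidean_space \<Rightarrow> real) \<Rightarrow> 'a \<Rightarrow> 'a" where
  "sphere_grad u x =
     (THE g. g \<in> tangent_space x \<and> (\<forall>v\<in>tangent_space x. g \<bullet> v = sphere_deriv u x v))"

text \<open>The Levi-Civita connection of the induced metric: the covariant derivative at \<open>x\<close> of a tangent
  vector field \<open>Y\<close> in direction \<open>v\<close> is the tangential component of its derivative in the ambient
  space.\<close>

definition sphere_nabla :: "'a::euclidean_space \<Rightarrow> ('a \<Rightarrow> 'a) \<Rightarrow> 'a \<Rightarrow> 'a" where
  "sphere_nabla v Y x = sphere_deriv Y x v - (sphere_deriv Y x v \<bullet> x) *\<^sub>R x"

definition sphere_hessian :: "('a::euclidean_space \<Rightarrow> real) \<Rightarrow> 'a \<Rightarrow> 'a \<Rightarrow> 'a \<Rightarrow> real" where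
  "sphere_hessian u x v w = sphere_nabla v (sphere_grad u) x \<bullet> w"

text \<open>The bilinear form \<open>\<nabla>\<^sup>2u + u I\<close> on the tangent space at \<open>x\<close>.\<close>

definition hess_plus :: "('a::euclidean_space \<Rightarrow> real) \<Rightarrow> 'a \<Rightarrow> 'a \<Rightarrow> 'a \<Rightarrow> real" where
  "hess_plus u x v w = sphere_hessian u x v w + u x * (v \<bullet> w)"

definition orthonormal_frame :: "'a::euclidean_space \<Rightarrow> (nat \<Rightarrow> 'a) \<Rightarrow> bool" where
  "orthonormal_frame x e \<longleftrightarrow> (\<forall>i<DIM('a) - 1. e i \<in> tangent_space x \<and>
     (\<forall>j<DIM('a) - 1. e i \<bullet> e j = (if i = j then 1 else 0)))"

definition frame_matrix :: "(nat \<Rightarrow> 'a::euclidean_space) \<Rightarrow> ('a \<Rightarrow> 'a \<Rightarrow> real) \<Rightarrow> real Matrix.mat" where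
  "frame_matrix e A = Matrix.mat (DIM('a) - 1) (DIM('a) - 1) (\<lambda>(i, j). A (e i) (e j))"

text \<open>The determinant of a bilinear form on the tangent space at \<open>x\<close>. A frame exists
  (\<open>orthonormal_frame_exists\<close>), and the choice does not matter (\<open>frame_det_eq\<close>).\<close>

definition frame_det :: "'a::euclidean_space \<Rightarrow> ('a \<Rightarrow> 'a \<Rightarrow> real) \<Rightarrow> real" where
  "frame_det x A = Determinant.det (frame_matrix (SOME e. orthonormal_frame x e) A)"

definition sigma_n :: "('a::euclidean_space \<Rightarrow> real) \<Rightarrow> 'a \<Rightarrow> real" where
  "sigma_n u x = frame_det x (hess_plus u x)"

definition smooth_solution ::
    "('a::euclidean_space \<Rightarrow> real) \<Rightarrow> real \<Rightarrow> real \<Rightarrow> real \<Rightarrow> ('a \<Rightarrow> real) \<Rightarrow> bool" where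
  "smooth_solution f \<alpha> \<beta> c u \<longleftrightarrow>
     smooth_on u (sphere 0 1) \<and>
     (\<forall>x\<in>sphere 0 1. u x > 0) \<and>
     (\<forall>x\<in>sphere 0 1. \<forall>v\<in>tangent_space x. v \<noteq> 0 \<longrightarrow> hess_plus u x v v > 0) \<and>
     (\<forall>x\<in>sphere 0 1. f x * u x powr (\<alpha> - 1) * sigma_n u x powr (- \<beta>) = c)"

section \<open>Independence of the frame\<close>

lemma orthonormal_frame_exists:
  fixes x :: "'a::euclidean_space"
  assumes "x \<in> sphere 0 1"
  shows "\<exists>e. orthonormal_frame x e"
proof -
  have x0: "x \<noteq> 0" using assms by auto
  have T: "tangent_space x = {y. x \<bullet> y = 0}"
    by (auto simp: tangent_space_def inner_commute)
  have d: "dim (tangent_space x) = DIM('a) - 1"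
    unfolding T using x0 by (rule dim_hyperplane)
  have sub: "subspace (tangent_space x)"
    unfolding T by (rule subspace_hyperplane)
  obtain B where B: "B \<subseteq> tangent_space x" "pairwise real_inner_class.orthogonal B" "\<And>b. b \<in> B \<Longrightarrow> norm b = 1"
    "independent B" "card B = dim (tangent_space x)" "span B = tangent_space x"
    using orthonormal_basis_subspace[OF sub] by metis
  have "finite B" using B(4) by (rule independent_imp_finite)
  then obtain e where e: "bij_betw e {0..<card B} B"
    using ex_bij_betw_nat_finite by blast
  have "orthonormal_frame x e"
    unfolding orthonormal_frame_def
  proof (intro allI impI conjI)
    fix i assume i: "i < DIM('a) - 1"
    have iB: "e i \<in> B" using e i B(5) d by (auto simp: bij_betw_def)
    then show "e i \<in> tangent_space x" using B(1) by auto
    fix j assume j: "j < DIM('a) - 1"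
    have jB: "e j \<in> B" using e j B(5) d by (auto simp: bij_betw_def)
    show "e i \<bullet> e j = (if i = j then 1 else 0)"
    proof (cases "i = j")
      case True
      then show ?thesis using B(3)[OF iB] by (simp add: norm_eq_1)
    next
      case False
      then have "e i \<noteq> e j"
        using e i j B(5) d by (auto simp: bij_betw_def inj_on_def)
      then show ?thesis using B(2) iB jB False by (auto simp: pairwise_def real_inner_class.orthogonal_def)
    qed
  qed
  then show ?thesis by blast
qed

lemma orthonormal_frame_expand:
  fixes x :: "'a::euclidean_space"
  assumes x: "x \<in> sphere 0 1" and e: "orthonormal_frame x e" and v: "v \<in> tangent_space x"
  shows "v = (\<Sum>k\<in>{0..<DIM('a) - 1}. (v \<bullet> e k) *\<^sub>R e k)"
proof -
  let ?n = "DIM('a) - 1"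
  let ?B = "e ` {0..<?n}"
  have T: "tangent_space x = {y. x \<bullet> y = 0}"
    by (auto simp: tangent_space_def inner_commute)
  have d: "dim (tangent_space x) = ?n"
    unfolding T using x by (intro dim_hyperplane) auto
  have sub: "subspace (tangent_space x)"
    unfolding T by (rule subspace_hyperplane)
  have on: "e i \<bullet> e j = (if i = j then 1 else 0)" if "i < ?n" "j < ?n" for i j
    using e that by (auto simp: orthonormal_frame_def)
  have inj: "inj_on e {0..<?n}"
    by (rule inj_onI) (metis on atLeastLessThan_iff zero_neq_one)
  have ind: "independent ?B"
  proof (rule pairwise_orthogonal_independent)
    show "pairwise real_inner_class.orthogonal ?B" using on by (auto simp: pairwise_def real_inner_class.orthogonal_def)
    show "0 \<notin> ?B" using on by (metis (no_types, lifting) atLeastLessThan_iff imageE inner_zero_left zero_neq_one)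
  qed
  have BT: "?B \<subseteq> tangent_space x" using e by (auto simp: orthonormal_frame_def)
  have "card ?B = ?n" using inj by (simp add: card_image)
  then have "tangent_space x \<subseteq> span ?B"
    using card_eq_dim[OF BT] ind d by simp
  then have vs: "v \<in> span ?B" using v by auto
  let ?w = "v - (\<Sum>k\<in>{0..<?n}. (v \<bullet> e k) *\<^sub>R e k)"
  have "?w \<in> span ?B"
    by (intro span_diff[OF vs] span_sum span_scale span_base) blast
  moreover have "real_inner_class.orthogonal ?w b" if b: "b \<in> ?B" for b
  proof -
    obtain j where j: "j < ?n" "b = e j" using b by auto
    have "(\<Sum>k\<in>{0..<?n}. (v \<bullet> e k) *\<^sub>R e k) \<bullet> e j
        = (\<Sum>k\<in>{0..<?n}. if k = j then v \<bullet> e k else 0)"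
      unfolding inner_sum_left using on j by (intro sum.cong) auto
    also have "\<dots> = v \<bullet> e j" using j by simp
    finally show ?thesis using j by (simp add: real_inner_class.orthogonal_def inner_diff_left)
  qed
  ultimately have "real_inner_class.orthogonal ?w ?w"
    using orthogonal_to_span by blast
  then show ?thesis by (simp add: real_inner_class.orthogonal_def)
qed

lemma frame_det_eq:
  fixes x :: "'a::euclidean_space"
  assumes x: "x \<in> sphere 0 1" and e: "orthonormal_frame x e" and A: "bilinear A"
  shows "frame_det x A = Determinant.det (frame_matrix e A)"
proof -
  let ?n = "DIM('a) - 1"
  define e' where "e' = (SOME e. orthonormal_frame x e)"
  have e': "orthonormal_frame x e'"
    unfolding e'_def using orthonormal_frame_exists[OF x] by (rule someI_ex)
  define Q where "Q = Matrix.mat ?n ?n (\<lambda>(i, j). e' i \<bullet> e j)"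
  have Q: "Q \<in> carrier_mat ?n ?n" by (simp add: Q_def)
  have M: "frame_matrix e A \<in> carrier_mat ?n ?n" by (simp add: frame_matrix_def)
  have ex: "e' i = (\<Sum>k\<in>{0..<?n}. (e' i \<bullet> e k) *\<^sub>R e k)" if "i < ?n" for i
    using orthonormal_frame_expand[OF x e] e' that by (auto simp: orthonormal_frame_def)
  have QQ: "Q * transpose_mat Q = 1\<^sub>m ?n"
  proof (rule eq_matI)
    fix i j assume "i < dim_row (1\<^sub>m ?n :: real Matrix.mat)" "j < dim_col (1\<^sub>m ?n :: real Matrix.mat)"
    then have ij: "i < ?n" "j < ?n" by auto
    have "(Q * transpose_mat Q) $$ (i, j) = (\<Sum>k\<in>{0..<?n}. (e' i \<bullet> e k) * (e' j \<bullet> e k))"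
      using ij by (simp add: Q_def scalar_prod_def)
    also have "\<dots> = e' i \<bullet> (\<Sum>k\<in>{0..<?n}. (e' j \<bullet> e k) *\<^sub>R e k)"
      by (simp add: inner_sum_right mult.commute)
    also have "\<dots> = e' i \<bullet> e' j" using ex[OF ij(2)] by simp
    finally show "(Q * transpose_mat Q) $$ (i, j) = 1\<^sub>m ?n $$ (i, j)"
      using e' ij by (auto simp: orthonormal_frame_def)
  qed (auto simp: Q_def)
  have eq: "frame_matrix e' A = Q * frame_matrix e A * transpose_mat Q"
  proof (rule eq_matI)
    fix i j assume "i < dim_row (Q * frame_matrix e A * transpose_mat Q)"
      "j < dim_col (Q * frame_matrix e A * transpose_mat Q)"
    then have ij: "i < ?n" "j < ?n" by (auto simp: Q_def)
    have "A (e' i) (e' j) = A (\<Sum>k\<in>{0..<?n}. (e' i \<bullet> e k) *\<^sub>R e k) (\<Sum>l\<in>{0..<?n}. (e' j \<bullet> e l) *\<^sub>R e l)"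
      using ex ij by metis
    also have "\<dots> = (\<Sum>(k, l)\<in>{0..<?n} \<times> {0..<?n}. A ((e' i \<bullet> e k) *\<^sub>R e k) ((e' j \<bullet> e l) *\<^sub>R e l))"
      by (rule bilinear_sum[OF A])
    also have "\<dots> = (\<Sum>k\<in>{0..<?n}. \<Sum>l\<in>{0..<?n}. (e' i \<bullet> e k) * ((e' j \<bullet> e l) * A (e k) (e l)))"
      by (simp add: sum.cartesian_product bilinear_lmul[OF A] bilinear_rmul[OF A] mult.left_commute)
    also have "\<dots> = (\<Sum>l\<in>{0..<?n}. \<Sum>k\<in>{0..<?n}. (e' i \<bullet> e k) * ((e' j \<bullet> e l) * A (e k) (e l)))"
      by (rule sum.swap)
    also have "\<dots> = (Q * frame_matrix e A * transpose_mat Q) $$ (i, j)"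
      using ij by (simp add: Q_def frame_matrix_def scalar_prod_def sum_distrib_left sum_distrib_right
          mult.commute mult.left_commute)
    finally show "frame_matrix e' A $$ (i, j) = (Q * frame_matrix e A * transpose_mat Q) $$ (i, j)"
      using ij by (simp add: frame_matrix_def)
  qed (auto simp: Q_def frame_matrix_def)
  have "Determinant.det Q * Determinant.det Q = 1"
    using det_mult[OF Q transpose_carrier_mat[THEN iffD2, OF Q]] QQ det_transpose[OF Q] by simp
  moreover have "Determinant.det (frame_matrix e' A) = Determinant.det Q * Determinant.det (frame_matrix e A) * Determinant.det Q"
    unfolding eq using Q M det_transpose[OF Q]
    by (simp add: det_mult[of _ ?n])
  ultimately show ?thesis
    unfolding frame_det_def e'_def[symmetric] by (simp add: mult.commute mult.left_commute)
qed

end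

theory Submission
  imports Defs
begin

text \<open>Let \<open>q = (\<alpha> - 1) / \<beta>\<close>, so that \<open>0 < q < n\<close>, let \<open>u\<^sub>1\<close> and \<open>u\<^sub>2\<close> be solutions, \<open>r = u\<^sub>1 / u\<^sub>2\<close>, and
  let \<open>A\<^sub>i\<close> be the form \<open>\<nabla>\<^sup>2u\<^sub>i + u\<^sub>i I\<close>. Dividing the two equations gives \<open>det A\<^sub>1 / det A\<^sub>2 = r\<^sup>q\<close>. The operator
  \<open>u \<mapsto> det A\<^sub>2 tr (A\<^sub>2\<^sup>-\<^sup>1 (\<nabla>\<^sup>2u + u I))\<close> is self-adjoint on the sphere, because the cofactors of \<open>A\<^sub>2\<close> are
  divergence free. Pairing its value at \<open>u\<^sub>1\<close> with \<open>u\<^sub>2\<close>, and bounding the trace from below by the inequality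
  between the arithmetic and the geometric mean, yields \<open>\<integral> u\<^sub>2 det A\<^sub>2 (r - r\<^sup>p) \<ge> 0\<close> with \<open>p = q / n\<close>. The same
  argument with the solutions exchanged yields, after expressing \<open>u\<^sub>1 det A\<^sub>1\<close> by \<open>u\<^sub>2 det A\<^sub>2\<close> and \<open>r\<close>, the
  inequality \<open>\<integral> u\<^sub>2 det A\<^sub>2 (r\<^sup>q - r\<^bsup>1 + q - p\<^esup>) \<ge> 0\<close>. The two integrands add up to
  \<open>- u\<^sub>2 det A\<^sub>2 (r\<^sup>q - r\<^sup>p) (r\<^bsup>1 - p\<^esup> - 1)\<close>. Since \<open>p < q\<close> (here \<open>n \<ge> 2\<close> is used) and \<open>p < 1\<close>, both brackets
  have the sign of \<open>r - 1\<close>, so this sum is nowhere positive; as its integral is nonnegative, it vanishes and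
  \<open>r = 1\<close>.

  The integrals are taken over the ambient space instead of the sphere. The extension of \<open>u\<close> to a positively
  homogeneous function \<open>H\<close> of degree one has a Hessian that annihilates the radial direction and restricts to
  \<open>\<nabla>\<^sup>2u + u I\<close> on tangent vectors (\<open>hess_plus_restriction\<close>), and the Hessian of \<open>H\<^sup>2 / 2\<close> is positive definite,
  with a determinant that is a positive multiple of \<open>det A\<close> (\<open>det_hess_half_square\<close>). Integration by parts needs only
  compactly supported fields (\<open>integral_divergence_annular\<close>). Cutting off by a function of \<open>K\<close>, the extension of
  \<open>u\<^sub>2\<close>, produces no additional term, because the inverse Hessian of \<open>K\<^sup>2 / 2\<close> maps the gradient of \<open>K\<close> to the
  radial direction (\<open>integral_gauge_identity\<close>). The exchanged inequality comes with a cutoff by \<open>H\<close>; it is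
  transported to the cutoff by \<open>K\<close> with a further divergence (\<open>integral_gauge_independent\<close>), and
  \<open>smooth_gauge_unique\<close> adds the two.\<close>

no_notation vec_index (infixl \<open>$\<close> 100)
no_notation Matrix.scalar_prod (infix \<open>\<bullet>\<close> 70)
hide_const (open) Determinant.det Matrix.mat Matrix.row
hide_fact (open) Matrix.vec_eq_iff Matrix.row_def Matrix.mat_def

section \<open>Functions of class \<open>C\<^sup>k\<close>\<close>

lemma C_k_on_subset: "C_k_on k f U \<Longrightarrow> V \<subseteq> U \<Longrightarrow> C_k_on k f V"
  by (induction k arbitrary: f) (auto intro: continuous_on_subset)

lemma C_k_on_cong:
  assumes "open U" "\<And>x. x \<in> U \<Longrightarrow> f x = g x"
  shows "C_k_on k f U \<longleftrightarrow> C_k_on k g U"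
  using assms(2)
proof (induction k arbitrary: f g)
  case 0
  then show ?case by (auto cong: continuous_on_cong)
next
  case (Suc k)
  have *: "(f has_derivative D) (at x) \<longleftrightarrow> (g has_derivative D) (at x)" if "x \<in> U" for x D
    using that Suc.prems assms(1) has_derivative_transform_within_open[of f D x UNIV U g]
      has_derivative_transform_within_open[of g D x UNIV U f] by auto
  have d: "f differentiable (at x) \<longleftrightarrow> g differentiable (at x)"
    and fd: "frechet_derivative f (at x) = frechet_derivative g (at x)" if "x \<in> U" for x
    using *[OF that] by (auto simp: differentiable_def frechet_derivative_def)
  have "C_k_on k (\<lambda>x. frechet_derivative f (at x) v) U \<longleftrightarrow> C_k_on k (\<lambda>x. frechet_derivative g (at x) v) U" for v
    by (rule Suc.IH) (simp add: fd)
  then show ?case using d by auto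
qed

lemma C_k_on_local:
  assumes "open U" "\<And>x. x \<in> U \<Longrightarrow> \<exists>V. open V \<and> x \<in> V \<and> C_k_on k f V"
  shows "C_k_on k f U"
  using assms(2)
proof (induction k arbitrary: f)
  case 0
  have "isCont f x" if "x \<in> U" for x
    using 0[OF that] by (auto simp: continuous_on_eq_continuous_at)
  then show ?case by (auto intro: continuous_at_imp_continuous_on)
next
  case (Suc k)
  have "f differentiable (at x)" if "x \<in> U" for x
    using Suc.prems[OF that] by auto
  moreover have "C_k_on k (\<lambda>x. frechet_derivative f (at x) v) U" for v
    using Suc.prems by (intro Suc.IH) fastforce
  ultimately show ?case by auto
qed

lemma C_k_on_imp_continuous_on: "C_k_on k f U \<Longrightarrow> continuous_on U f"
  by (cases k) (auto intro!: continuous_at_imp_continuous_on differentiable_imp_continuous_within)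

lemma C_k_on_SucD: "C_k_on (Suc k) f U \<Longrightarrow> C_k_on k f U"
proof (induction k arbitrary: f)
  case 0
  then show ?case using C_k_on_imp_continuous_on by fastforce
next
  case (Suc k)
  then show ?case by (metis C_k_on.simps(2))
qed

lemma C_k_on_mono: "C_k_on k f U \<Longrightarrow> j \<le> k \<Longrightarrow> C_k_on j f U"
  by (induction k) (auto simp: le_Suc_eq dest: C_k_on_SucD simp del: C_k_on.simps)

lemma C_k_on_SucI:
  assumes "open U" "\<And>x. x \<in> U \<Longrightarrow> (f has_derivative D x) (at x)"
    "\<And>v. C_k_on k (\<lambda>x. D x v) U"
  shows "C_k_on (Suc k) f U"
proof -
  have "D x = frechet_derivative f (at x)" if "x \<in> U" for x
    using frechet_derivative_at[OF assms(2)[OF that]] .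
  then have "C_k_on k (\<lambda>x. frechet_derivative f (at x) v) U" for v
    using C_k_on_cong[OF assms(1), of "\<lambda>x. D x v" "\<lambda>x. frechet_derivative f (at x) v" k] assms(3) by simp
  then show ?thesis using assms(2) by (auto simp: differentiable_def)
qed

lemma C_k_on_has_derivative:
  "C_k_on (Suc k) f U \<Longrightarrow> x \<in> U \<Longrightarrow> (f has_derivative frechet_derivative f (at x)) (at x)"
  by (auto simp: frechet_derivative_works)

lemma C_k_on_const: "open U \<Longrightarrow> C_k_on k (\<lambda>x. c) U"
proof (induction k arbitrary: c)
  case (Suc k)
  show ?case
    by (rule C_k_on_SucI[where D = "\<lambda>_ _. 0"]) (use Suc in auto)
qed auto

lemma C_k_on_linear:
  assumes "bounded_linear L" "open U"
  shows "C_k_on k L U"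
proof (cases k)
  case 0
  then show ?thesis by (simp add: assms linear_continuous_on)
next
  case (Suc j)
  show ?thesis unfolding Suc
    by (rule C_k_on_SucI[where D = "\<lambda>_ . L"])
      (use assms in \<open>auto intro: bounded_linear_imp_has_derivative C_k_on_const\<close>)
qed

lemma C_k_on_add:
  assumes "open U" "C_k_on k f U" "C_k_on k g U"
  shows "C_k_on k (\<lambda>x. f x + g x) U"
  using assms(2,3)
proof (induction k arbitrary: f g)
  case 0
  then show ?case by (auto intro: continuous_intros)
next
  case (Suc k)
  show ?case
    by (rule C_k_on_SucI[OF assms(1) has_derivative_add[OF C_k_on_has_derivative[OF Suc.prems(1)]
            C_k_on_has_derivative[OF Suc.prems(2)]]])
      (use Suc in auto)
qed

lemma C_k_on_bilinear:
  assumes "bounded_bilinear prd" "open U" "C_k_on k f U" "C_k_on k g U"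
  shows "C_k_on k (\<lambda>x. prd (f x) (g x)) U"
  using assms(3,4)
proof (induction k arbitrary: f g)
  case 0
  then show ?case using bounded_bilinear.continuous_on[OF assms(1)] by auto
next
  case (Suc k)
  show ?case
  proof (rule C_k_on_SucI[OF assms(2) bounded_bilinear.FDERIV[OF assms(1)
          C_k_on_has_derivative[OF Suc.prems(1)] C_k_on_has_derivative[OF Suc.prems(2)]]])
    fix v
    have "C_k_on k (\<lambda>x. prd (f x) (frechet_derivative g (at x) v)) U"
      "C_k_on k (\<lambda>x. prd (frechet_derivative f (at x) v) (g x)) U"
      using Suc.prems C_k_on_SucD[OF Suc.prems(1)] C_k_on_SucD[OF Suc.prems(2)]
      by (auto intro!: Suc.IH)
    then show "C_k_on k (\<lambda>x. prd (f x) (frechet_derivative g (at x) v) +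
        prd (frechet_derivative f (at x) v) (g x)) U"
      by (rule C_k_on_add[OF assms(2)])
  qed
qed

lemmas C_k_on_scaleR = C_k_on_bilinear[OF bounded_bilinear_scaleR]
lemmas C_k_on_mult = C_k_on_bilinear[OF bounded_bilinear_mult]
lemmas C_k_on_inner = C_k_on_bilinear[OF bounded_bilinear_inner]

lemma C_k_on_minus:
  fixes f g :: "'a::real_normed_vector \<Rightarrow> 'b::real_normed_vector"
  assumes "open U" "C_k_on k f U" "C_k_on k g U"
  shows "C_k_on k (\<lambda>x. f x - g x) U"
  using C_k_on_add[OF assms(1,2) C_k_on_scaleR[OF assms(1) C_k_on_const[OF assms(1), of k "-1"] assms(3)]]
  by simp

lemma C_k_on_sum:
  assumes "open U" "\<And>i. i \<in> I \<Longrightarrow> C_k_on k (f i) U"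
  shows "C_k_on k (\<lambda>x. \<Sum>i\<in>I. f i x) U"
  using assms(2)
  by (induction I rule: infinite_finite_induct) (auto intro!: C_k_on_add C_k_on_const assms(1))

lemma C_k_on_prod:
  fixes f :: "'i \<Rightarrow> 'a::real_normed_vector \<Rightarrow> real"
  assumes "open U" "\<And>i. i \<in> I \<Longrightarrow> C_k_on k (f i) U"
  shows "C_k_on k (\<lambda>x. \<Prod>i\<in>I. f i x) U"
  using assms(2)
  by (induction I rule: infinite_finite_induct) (auto intro!: C_k_on_mult C_k_on_const assms(1))

text \<open>Expanding the inner derivative in a basis turns the chain rule into a finite sum of products with
  directional derivatives of the outer function, to which the induction hypothesis applies.\<close>

lemma C_k_on_compose:
  fixes g :: "'a::real_normed_vector \<Rightarrow> 'b::euclidean_space"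
  assumes "open U" "open V" "C_k_on k f V" "C_k_on k g U" "g ` U \<subseteq> V"
  shows "C_k_on k (\<lambda>x. f (g x)) U"
  using assms(3,4)
proof (induction k arbitrary: f)
  case 0
  then show ?case using continuous_on_compose2[of V f U g] assms(5) by auto
next
  case (Suc k)
  let ?D = "\<lambda>x v. \<Sum>b\<in>Basis. (frechet_derivative g (at x) v \<bullet> b) *\<^sub>R frechet_derivative f (at (g x)) b"
  show ?case
  proof (rule C_k_on_SucI[OF assms(1)])
    fix x assume x: "x \<in> U"
    have f': "(f has_derivative frechet_derivative f (at (g x))) (at (g x))"
      using C_k_on_has_derivative[OF Suc.prems(1)] x assms(5) by auto
    have "((\<lambda>x. f (g x)) has_derivative (\<lambda>v. frechet_derivative f (at (g x)) (frechet_derivative g (at x) v))) (at x)"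
      using has_derivative_compose[OF C_k_on_has_derivative[OF Suc.prems(2) x] f'] .
    moreover have "frechet_derivative f (at (g x)) w = (\<Sum>b\<in>Basis. (w \<bullet> b) *\<^sub>R frechet_derivative f (at (g x)) b)" for w
    proof -
      have l: "linear (frechet_derivative f (at (g x)))"
        using f' has_derivative_linear by blast
      have "frechet_derivative f (at (g x)) w = frechet_derivative f (at (g x)) (\<Sum>b\<in>Basis. (w \<bullet> b) *\<^sub>R b)"
        by (simp add: euclidean_representation)
      then show ?thesis by (simp add: linear_sum[OF l] linear_cmul[OF l])
    qed
    ultimately show "((\<lambda>x. f (g x)) has_derivative ?D x) (at x)"
      by (metis (no_types, lifting) ext)
  next
    fix v
    show "C_k_on k (\<lambda>x. ?D x v) U"
      using Suc.prems C_k_on_SucD[OF Suc.prems(2)]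
      by (intro C_k_on_sum C_k_on_scaleR C_k_on_inner C_k_on_const assms(1) Suc.IH) auto
  qed
qed

lemma C_k_on_powr: "C_k_on k (\<lambda>s::real. s powr a) {0<..}"
proof (induction k arbitrary: a)
  case 0
  then show ?case by (auto intro!: continuous_intros)
next
  case (Suc k)
  show ?case
  proof (rule C_k_on_SucI)
    fix s :: real assume "s \<in> {0<..}"
    then have "((\<lambda>s. s powr a) has_derivative (*) (a * s powr (a - 1))) (at s)"
      using has_real_derivative_powr[of s a] by (simp add: has_field_derivative_def)
    moreover have "(*) (a * s powr (a - 1)) = (\<lambda>v. v * (a * s powr (a - 1)))"
      by (simp add: fun_eq_iff)
    ultimately show "((\<lambda>s. s powr a) has_derivative (\<lambda>v. v * (a * s powr (a - 1)))) (at s)"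
      by simp
  next
    show "C_k_on k (\<lambda>s. v * (a * s powr (a - 1))) {0<..}" for v
      by (intro C_k_on_mult C_k_on_const Suc) auto
  qed auto
qed

lemma C_k_on_powr_compose:
  fixes g :: "'a::real_normed_vector \<Rightarrow> real"
  assumes "open U" "C_k_on k g U" "\<And>x. x \<in> U \<Longrightarrow> g x > 0"
  shows "C_k_on k (\<lambda>x. g x powr a) U"
  by (rule C_k_on_compose[where V = "{0<..}" and f = "\<lambda>s::real. s powr a"])
    (use assms C_k_on_powr in auto)

lemma C_k_on_norm_powr: "C_k_on k (\<lambda>x::'a::euclidean_space. norm x powr a) (- {0})"
proof -
  have "norm x powr a = (x \<bullet> x) powr (a / 2)" if "x \<noteq> 0" for x :: 'a
  proof -
    have "x \<bullet> x = norm x powr 2" using that by (simp add: dot_square_norm powr_numeral)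
    then show ?thesis using that by (simp add: powr_powr del: powr_numeral)
  qed
  then have "C_k_on k (\<lambda>x::'a. norm x powr a) (- {0}) = C_k_on k (\<lambda>x::'a. (x \<bullet> x) powr (a / 2)) (- {0})"
    by (intro C_k_on_cong) auto
  also have \<dots>
    by (intro C_k_on_powr_compose C_k_on_inner C_k_on_linear[OF bounded_linear_ident]) auto
  finally show ?thesis .
qed

text \<open>Near a ray, \<open>u\<close> may be replaced by a smooth function on an open set, composed with the retraction to
  the sphere.\<close>

lemma C_k_on_radial_extension:
  fixes u :: "'a::euclidean_space \<Rightarrow> real"
  assumes "smooth_on u (sphere 0 1)"
  shows "C_k_on k (\<lambda>x. norm x * u (x /\<^sub>R norm x)) (- {0})"
proof (rule C_k_on_local)
  fix x :: 'a assume x: "x \<in> - {0}"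
  then have "x /\<^sub>R norm x \<in> sphere 0 1" by simp
  then obtain U F where U: "open U" "x /\<^sub>R norm x \<in> U" "C_k_on k F U" "\<And>y. y \<in> sphere 0 1 \<inter> U \<Longrightarrow> F y = u y"
    using assms unfolding smooth_on_def by metis
  let ?r = "\<lambda>y::'a. y /\<^sub>R norm y"
  let ?V = "(- {0}) \<inter> ?r -` U"
  have cr: "C_k_on k ?r (- {0})" for k
  proof -
    have "C_k_on k (\<lambda>y::'a. (norm y powr -1) *\<^sub>R y) (- {0})"
      by (intro C_k_on_scaleR C_k_on_norm_powr C_k_on_linear[OF bounded_linear_ident]) auto
    also have "?this = C_k_on k ?r (- {0})"
      by (intro C_k_on_cong) (auto simp: powr_minus)
    finally show ?thesis .
  qed
  have oV: "open ?V"
    using C_k_on_imp_continuous_on[OF cr[of 0]] U(1) continuous_open_preimage[of "- {0}" ?r U] by (simp add: open_Compl)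
  have n: "C_k_on k (\<lambda>y::'a. norm y powr 1) ?V"
    by (rule C_k_on_subset[OF C_k_on_norm_powr]) auto
  have "C_k_on k (\<lambda>y. norm y powr 1 * F (?r y)) ?V"
    by (intro C_k_on_mult[OF oV n] C_k_on_compose[OF oV U(1,3)] C_k_on_subset[OF cr]) auto
  also have "?this = C_k_on k (\<lambda>x. norm x * u (x /\<^sub>R norm x)) ?V"
    by (intro C_k_on_cong[OF oV]) (auto simp: U(4))
  finally show "\<exists>V. open V \<and> x \<in> V \<and> C_k_on k (\<lambda>x. norm x * u (x /\<^sub>R norm x)) V"
    using oV x U(2) by (intro exI[of _ ?V]) auto
qed auto

section \<open>Partial derivatives and integration by parts\<close>

definition pd :: "'m \<Rightarrow> (real^'m \<Rightarrow> real) \<Rightarrow> real^'m \<Rightarrow> real" where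
  "pd i f x = frechet_derivative f (at x) (axis i 1)"

lemma C_k_on_pd: "C_k_on (Suc k) f U \<Longrightarrow> C_k_on k (pd i f) U"
  unfolding pd_def[abs_def] by simp

lemma pd_eqI: "(f has_derivative D) (at x) \<Longrightarrow> pd i f x = D (axis i 1)"
  unfolding pd_def by (simp flip: frechet_derivative_at)

lemma pd_cong:
  assumes "open U" "x \<in> U" "\<And>y. y \<in> U \<Longrightarrow> f y = g y"
  shows "pd i f x = pd i g x"
proof -
  have "(f has_derivative D) (at x) \<longleftrightarrow> (g has_derivative D) (at x)" for D
    using has_derivative_transform_within_open[of f D x UNIV U g]
      has_derivative_transform_within_open[of g D x UNIV U f] assms by auto
  then show ?thesis by (simp add: pd_def frechet_derivative_def)
qed

lemma vec_basis_sum: "v = (\<Sum>i\<in>UNIV. v $ i *\<^sub>R axis i (1::real))"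
  using basis_expansion[of v] by (simp add: scalar_mult_eq_scaleR)

lemma has_derivative_pd:
  fixes f :: "real^'m \<Rightarrow> real"
  assumes "f differentiable (at x)"
  shows "(f has_derivative (\<lambda>v. \<Sum>i\<in>UNIV. v $ i * pd i f x)) (at x)"
proof -
  have D: "(f has_derivative frechet_derivative f (at x)) (at x)"
    using assms frechet_derivative_works by blast
  then have l: "linear (frechet_derivative f (at x))" by (rule has_derivative_linear)
  have "frechet_derivative f (at x) v = (\<Sum>i\<in>UNIV. v $ i * pd i f x)" for v
    by (subst vec_basis_sum[of v]) (simp add: linear_sum[OF l] linear_cmul[OF l] pd_def)
  then have "frechet_derivative f (at x) = (\<lambda>v. \<Sum>i\<in>UNIV. v $ i * pd i f x)" by auto
  then show ?thesis using D by simp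
qed

lemma has_real_derivative_along_axis:
  fixes f :: "real^'m \<Rightarrow> real"
  assumes "f differentiable (at (y + s *\<^sub>R axis i 1))"
  shows "((\<lambda>s. f (y + s *\<^sub>R axis i 1)) has_real_derivative pd i f (y + s *\<^sub>R axis i 1)) (at s)"
proof -
  let ?z = "y + s *\<^sub>R axis i 1"
  have "(f has_derivative frechet_derivative f (at ?z)) (at ?z)"
    using assms frechet_derivative_works by blast
  moreover have "((\<lambda>s. y + s *\<^sub>R axis i 1) has_derivative (\<lambda>h. h *\<^sub>R axis i 1)) (at s)"
    by (auto intro!: derivative_eq_intros)
  ultimately have "((\<lambda>s. f (y + s *\<^sub>R axis i 1)) has_derivative (\<lambda>h. frechet_derivative f (at ?z) (h *\<^sub>R axis i 1))) (at s)"
    using has_derivative_compose by blast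
  moreover have "frechet_derivative f (at ?z) (h *\<^sub>R axis i 1) = pd i f ?z * h" for h
    using linear_cmul[OF linear_frechet_derivative[OF assms]] by (simp add: pd_def mult.commute)
  ultimately show ?thesis unfolding has_field_derivative_def by (metis (no_types, lifting) ext)
qed

text \<open>The second difference is symmetric in \<open>i\<close> and \<open>j\<close>, while the mean value theorem, used first along \<open>i\<close>
  and then along \<open>j\<close>, produces the derivatives in a definite order. Comparing both orders for small \<open>h\<close> shows
  that mixed derivatives commute.\<close>

lemma second_difference_mean_value:
  fixes f :: "real^'m \<Rightarrow> real"
  assumes f: "C_k_on 2 f (ball x r)" and h: "0 < h" "2 * h < r"
  shows "\<exists>y\<in>ball x (2 * h). f (x + h *\<^sub>R axis i 1 + h *\<^sub>R axis j 1) - f (x + h *\<^sub>R axis i 1)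
    - f (x + h *\<^sub>R axis j 1) + f x = h * h * pd j (pd i f) y"
proof -
  let ?p = "\<lambda>s t. x + s *\<^sub>R axis i 1 + t *\<^sub>R axis j 1"
  have near: "dist x (?p s t) \<le> s + t" if "0 \<le> s" "0 \<le> t" for s t
    using norm_triangle_ineq[of "s *\<^sub>R axis i (1::real)" "t *\<^sub>R axis j 1"] that
    by (simp add: dist_norm norm_minus_commute algebra_simps)
  have inb: "?p s t \<in> ball x r" if "0 \<le> s" "0 \<le> t" "s \<le> h" "t \<le> h" for s t
    using near[of s t] that h by auto
  have df: "f differentiable (at y)" "pd i f differentiable (at y)" if "y \<in> ball x r" for y
    using f that C_k_on_pd[of 1 f "ball x r" i] by (auto simp: numeral_2_eq_2)
  have d1: "((\<lambda>s. f (?p s t)) has_real_derivative pd i f (?p s t)) (at s)"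
    if "0 \<le> s" "0 \<le> t" "s \<le> h" "t \<le> h" for s t
    using has_real_derivative_along_axis[of f "x + t *\<^sub>R axis j 1" s i] df(1)[OF inb[OF that]]
    by (simp add: algebra_simps)
  have "\<exists>s. 0 < s \<and> s < h \<and> (f (?p h h) - f (?p h 0)) - (f (?p 0 h) - f (?p 0 0)) =
      (h - 0) * (pd i f (?p s h) - pd i f (?p s 0))"
    using h by (intro MVT2 DERIV_diff d1) auto
  then obtain s where s: "0 < s" "s < h" "(f (?p h h) - f (?p h 0)) - (f (?p 0 h) - f (?p 0 0)) =
      h * (pd i f (?p s h) - pd i f (?p s 0))" by auto
  have "\<exists>t. 0 < t \<and> t < h \<and> pd i f (?p s h) - pd i f (?p s 0) = (h - 0) * pd j (pd i f) (?p s t)"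
    using h s by (intro MVT2 has_real_derivative_along_axis df(2) inb) auto
  then obtain t where t: "0 < t" "t < h" "pd i f (?p s h) - pd i f (?p s 0) = h * pd j (pd i f) (?p s t)"
    by auto
  show ?thesis
    using s t near[of s t] by (intro bexI[of _ "?p s t"]) (auto simp: algebra_simps)
qed

lemma pd_commute:
  fixes f :: "real^'m \<Rightarrow> real"
  assumes f: "C_k_on 2 f U" and U: "open U" "x \<in> U"
  shows "pd i (pd j f) x = pd j (pd i f) x"
proof -
  obtain r where r: "r > 0" "ball x r \<subseteq> U" using U openE by blast
  have fr: "C_k_on 2 f (ball x r)" using f r C_k_on_subset by blast
  let ?h = "\<lambda>n. r / (2 * (real n + 2))"
  have h: "0 < ?h n" "2 * ?h n < r" for n
    using r by (auto simp: field_simps intro!: add_pos_nonneg)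
  have "\<exists>y z. y \<in> ball x (2 * ?h n) \<and> z \<in> ball x (2 * ?h n) \<and> pd j (pd i f) y = pd i (pd j f) z" for n
    using second_difference_mean_value[OF fr h(1)[of n] h(2)[of n], of i j]
      second_difference_mean_value[OF fr h(1)[of n] h(2)[of n], of j i] h(1)[of n]
    by (smt (verit) add.commute add.left_commute mult_cancel_left mult_eq_0_iff)
  then obtain y z where yz: "\<And>n. y n \<in> ball x (2 * ?h n)" "\<And>n. z n \<in> ball x (2 * ?h n)"
    "\<And>n. pd j (pd i f) (y n) = pd i (pd j f) (z n)" by metis
  have lim0: "(\<lambda>n. 2 * ?h n) \<longlonglongrightarrow> 0" by real_asymp
  have "y \<longlonglongrightarrow> x" "z \<longlonglongrightarrow> x"
  proof -
    have "dist (y n) x \<le> dist (2 * ?h n) 0" "dist (z n) x \<le> dist (2 * ?h n) 0" for n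
      using yz(1,2)[of n] r by (simp_all add: dist_commute abs_mult)
    then show "y \<longlonglongrightarrow> x" "z \<longlonglongrightarrow> x"
      by (blast intro: metric_tendsto_imp_tendsto[OF lim0] always_eventually)+
  qed
  have c: "isCont (pd a (pd b f)) x" for a b
  proof -
    have "continuous_on U (pd a (pd b f))"
      using f C_k_on_pd[of 1 f U b] C_k_on_pd[of 0 "pd b f" U a] by (simp add: numeral_2_eq_2 del: C_k_on.simps(2))
    then show ?thesis using U by (simp add: continuous_on_eq_continuous_at)
  qed
  have "(\<lambda>n. pd j (pd i f) (y n)) \<longlonglongrightarrow> pd j (pd i f) x" "(\<lambda>n. pd i (pd j f) (z n)) \<longlonglongrightarrow> pd i (pd j f) x"
    using isCont_tendsto_compose[OF c \<open>y \<longlonglongrightarrow> x\<close>] isCont_tendsto_compose[OF c \<open>z \<longlonglongrightarrow> x\<close>] by auto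
  then show ?thesis using yz(3) LIMSEQ_unique by simp
qed

lemma integrable_compact_support:
  fixes f :: "'a::euclidean_space \<Rightarrow> real"
  assumes "continuous_on UNIV f" "\<And>x. norm x > R \<Longrightarrow> f x = 0"
  shows "integrable lborel f"
proof -
  have "integrable lborel (\<lambda>x. indicator (cball 0 R) x *\<^sub>R f x)"
    using assms(1) by (intro borel_integrable_compact) (auto intro: continuous_on_subset)
  also have "(\<lambda>x. indicator (cball 0 R) x *\<^sub>R f x) = f"
    using assms(2) by (force simp: indicator_def)
  finally show ?thesis .
qed

lemma integral_lborel_translate:
  fixes f :: "'a::euclidean_space \<Rightarrow> real"
  assumes "continuous_on UNIV f"
  shows "(\<integral>x. f (x + c) \<partial>lborel) = (\<integral>x. f x \<partial>lborel)"
proof -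
  have "(\<integral>x. f x \<partial>lborel) = (\<integral>x. f x \<partial>distr lborel borel ((+) c))"
    by (simp add: lborel_distr_plus)
  also have "\<dots> = (\<integral>x. f (c + x) \<partial>lborel)"
    using assms by (intro integral_distr) (auto intro: borel_measurable_continuous_onI)
  finally show ?thesis by (simp add: add.commute)
qed

text \<open>The integral of a difference quotient vanishes by translation invariance, and the difference quotients
  converge to the derivative dominated by a multiple of the indicator of a ball.\<close>

lemma integral_pd_compact_support:
  fixes f :: "real^'m \<Rightarrow> real"
  assumes f: "C_k_on 1 f UNIV" and R: "\<And>x. norm x > R \<Longrightarrow> f x = 0"
  shows "integrable lborel (pd i f)" "(\<integral>x. pd i f x \<partial>lborel) = 0"
proof -
  let ?e = "axis i (1::real) :: real^'m"
  have df: "f differentiable (at x)" for x using f by auto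
  have cf: "continuous_on UNIV f" using C_k_on_imp_continuous_on[OF f] .
  have cpd: "continuous_on UNIV (pd i f)" using C_k_on_pd[of 0 f UNIV i] f by simp
  have R': "pd i f x = 0" if "norm x > R" for x
  proof -
    have "open {x :: real^'m. norm x > R}" by (intro open_Collect_less continuous_intros)
    then have "pd i f x = pd i (\<lambda>_. 0) x" using that R by (intro pd_cong) auto
    also have "\<dots> = 0" by (simp add: pd_eqI[OF has_derivative_const])
    finally show ?thesis .
  qed
  show int: "integrable lborel (pd i f)" by (rule integrable_compact_support[OF cpd R'])
  have "bounded (pd i f ` cball 0 R)"
    using cpd by (intro compact_imp_bounded compact_continuous_image) (auto intro: continuous_on_subset)
  then obtain C where C: "C > 0" "\<And>x. x \<in> cball 0 R \<Longrightarrow> \<bar>pd i f x\<bar> \<le> C"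
    by (auto simp: bounded_pos)
  have Cb: "\<bar>pd i f x\<bar> \<le> C" for x using C R'[of x] by (cases "norm x > R") auto
  let ?h = "\<lambda>n. 1 / (real n + 1)"
  let ?q = "\<lambda>n x. (f (x + ?h n *\<^sub>R ?e) - f x) / ?h n"
  have "(\<lambda>n. \<integral>x. ?q n x \<partial>lborel) \<longlonglongrightarrow> (\<integral>x. pd i f x \<partial>lborel)"
  proof (rule integral_dominated_convergence)
    show "pd i f \<in> borel_measurable lborel" using int by auto
    show "?q n \<in> borel_measurable lborel" for n
    proof -
      have "continuous_on UNIV (\<lambda>x. f (x + ?h n *\<^sub>R ?e))"
        by (intro continuous_on_compose2[OF cf] continuous_intros) auto
      then show ?thesis using cf by (auto intro!: borel_measurable_continuous_onI continuous_intros)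
    qed
    show "integrable lborel (\<lambda>x. C * indicator (cball (0::real^'m) (R + 1)) x :: real)"
      using borel_integrable_compact[OF compact_cball, of "0 :: real^'m" "R + 1" "\<lambda>_. C"]
      by (simp add: mult.commute)
    show "AE x in lborel. (\<lambda>n. ?q n x) \<longlonglongrightarrow> pd i f x"
    proof (rule AE_I2)
      fix x
      have "((\<lambda>s. f (x + s *\<^sub>R ?e)) has_real_derivative pd i f x) (at 0)"
        using has_real_derivative_along_axis[of f x 0 i] df by simp
      then have "((\<lambda>h. (f (x + h *\<^sub>R ?e) - f x) / h) \<longlongrightarrow> pd i f x) (at 0)"
        by (simp add: DERIV_def)
      moreover have "filterlim ?h (at 0) sequentially" by real_asymp
      ultimately show "(\<lambda>n. ?q n x) \<longlonglongrightarrow> pd i f x"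
        by (rule filterlim_compose)
    qed
    show "AE x in lborel. norm (?q n x) \<le> C * indicator (cball (0::real^'m) (R + 1)) x" for n
    proof (rule AE_I2)
      fix x :: "real^'m"
      have h: "0 < ?h n" "?h n \<le> 1" by auto
      show "norm (?q n x) \<le> C * indicator (cball 0 (R + 1)) x"
      proof (cases "x \<in> cball 0 (R + 1)")
        case True
        have "\<exists>s. 0 < s \<and> s < ?h n \<and> f (x + ?h n *\<^sub>R ?e) - f (x + 0 *\<^sub>R ?e) = (?h n - 0) * pd i f (x + s *\<^sub>R ?e)"
          using h by (intro MVT2 has_real_derivative_along_axis df) auto
        then obtain s where "f (x + ?h n *\<^sub>R ?e) - f x = ?h n * pd i f (x + s *\<^sub>R ?e)" by auto
        then have "?q n x = pd i f (x + s *\<^sub>R ?e)" using h by (metis less_irrefl nonzero_mult_div_cancel_left)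
        then show ?thesis using Cb True by (simp only: real_norm_def) simp
      next
        case False
        have "norm (?h n *\<^sub>R ?e) \<le> 1" using h by simp
        moreover have "norm x > R + 1" using False by simp
        ultimately have "norm (x + ?h n *\<^sub>R ?e) > R" "norm x > R"
          using norm_diff_ineq[of x "?h n *\<^sub>R ?e"] by linarith+
        then show ?thesis using R False by simp
      qed
    qed
  qed
  moreover have "(\<integral>x. ?q n x \<partial>lborel) = 0" for n
  proof -
    have "continuous_on UNIV (\<lambda>x. f (x + ?h n *\<^sub>R ?e))"
      by (intro continuous_on_compose2[OF cf] continuous_intros) auto
    moreover have "f (x + ?h n *\<^sub>R ?e) = 0" if "norm x > R + 1" for x
    proof -
      have "norm (?h n *\<^sub>R ?e) \<le> 1" by simp
      then show ?thesis using that norm_diff_ineq[of x "?h n *\<^sub>R ?e"] by (intro R) linarith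
    qed
    ultimately have i1: "integrable lborel (\<lambda>x. f (x + ?h n *\<^sub>R ?e))"
      by (rule integrable_compact_support)
    have i2: "integrable lborel f" by (rule integrable_compact_support[OF cf R])
    show ?thesis
      using i1 i2 integral_lborel_translate[OF cf, of "?h n *\<^sub>R ?e"] by (simp add: Bochner_Integration.integral_diff)
  qed
  ultimately show "(\<integral>x. pd i f x \<partial>lborel) = 0" by (simp add: LIMSEQ_const_iff)
qed

text \<open>Compact support away from the origin: homogeneous functions are singular at the origin, and a factor of
  this kind makes their products smooth on the whole space.\<close>

definition annular :: "('a::real_normed_vector \<Rightarrow> real) \<Rightarrow> bool" where
  "annular f \<longleftrightarrow> (\<exists>a>0. \<exists>R. \<forall>x. norm x < a \<or> norm x > R \<longrightarrow> f x = 0)"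

lemma annular_weaken: "annular f \<Longrightarrow> (\<And>x. f x = 0 \<Longrightarrow> g x = 0) \<Longrightarrow> annular g"
  unfolding annular_def by metis

lemma C_k_on_UNIV_annular:
  fixes f :: "'a::real_normed_vector \<Rightarrow> real"
  assumes f: "C_k_on k f (- {0})" and a: "a > 0" "\<And>x. norm x < a \<Longrightarrow> f x = 0"
  shows "C_k_on k f UNIV"
proof (rule C_k_on_local)
  fix x :: 'a
  have "C_k_on k f (ball 0 a)"
    using C_k_on_cong[of "ball 0 a" f "\<lambda>_. 0" k] a C_k_on_const[of "ball 0 a"] by auto
  moreover have "x \<in> - {0} \<or> x \<in> ball 0 a" using a by auto
  ultimately show "\<exists>V. open V \<and> x \<in> V \<and> C_k_on k f V" using f by blast
qed auto

lemma integrable_annular: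
  fixes f :: "'a::euclidean_space \<Rightarrow> real"
  assumes "continuous_on (- {0}) f" "annular f"
  shows "integrable lborel f"
proof -
  obtain a R where "a > 0" "\<And>x. norm x < a \<Longrightarrow> f x = 0" "\<And>x. norm x > R \<Longrightarrow> f x = 0"
    using assms(2) unfolding annular_def by auto
  then show ?thesis
    using C_k_on_UNIV_annular[of 0 f a] assms(1) by (intro integrable_compact_support) auto
qed

lemma integral_divergence_annular:
  fixes V :: "'m \<Rightarrow> real^'m \<Rightarrow> real"
  assumes V: "\<And>i. C_k_on 1 (V i) (- {0})" "\<And>i. annular (V i)"
  shows "(\<integral>x. (\<Sum>i\<in>UNIV. pd i (V i) x) \<partial>lborel) = 0"
proof -
  have "integrable lborel (pd i (V i)) \<and> (\<integral>x. pd i (V i) x \<partial>lborel) = 0" for i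
  proof -
    obtain a R where "a > 0" "\<And>x. norm x < a \<Longrightarrow> V i x = 0" "\<And>x. norm x > R \<Longrightarrow> V i x = 0"
      using V(2)[of i] unfolding annular_def by auto
    then show ?thesis
      using C_k_on_UNIV_annular[OF V(1)[of i]] integral_pd_compact_support by blast
  qed
  then show ?thesis by (simp add: Bochner_Integration.integral_sum)
qed

section \<open>Relative eigenvalues and tangential determinants\<close>

lemma inner_matrix_sym:
  fixes B :: "real^'m^'m"
  assumes "transpose B = B"
  shows "v \<bullet> (B *v w) = w \<bullet> (B *v v)"
  by (metis assms dot_lmul_matrix inner_commute vector_transpose_matrix)

text \<open>A maximizer on \<open>W\<close> of the quotient of the quadratic forms of \<open>M\<close> and \<open>B\<close>, with maximum \<open>d\<close>, is a zero
  of the nonnegative form of \<open>d B - M\<close> on \<open>W\<close>, and so lies in the kernel of that form.\<close>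

lemma generalized_eigenvector:
  fixes B M :: "real^'m^'m"
  assumes B: "transpose B = B" and M: "transpose M = M"
    and pos: "\<And>v. v \<noteq> 0 \<Longrightarrow> v \<bullet> (B *v v) > 0"
    and W: "subspace W" "w0 \<in> W" "w0 \<noteq> 0"
  shows "\<exists>p\<in>W. \<exists>d. p \<bullet> (B *v p) = 1 \<and> (\<forall>w\<in>W. w \<bullet> (M *v p) = d * (w \<bullet> (B *v p)))"
proof -
  let ?b = "\<lambda>v. v \<bullet> (B *v v)" and ?m = "\<lambda>v. v \<bullet> (M *v v)"
  let ?S = "sphere 0 1 \<inter> W"
  have cpt: "compact ?S" by (intro compact_Int_closed compact_sphere closed_subspace W)
  have ne: "w0 /\<^sub>R norm w0 \<in> ?S"
    using W by (auto intro: subspace_scale)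
  have nz: "v \<noteq> 0" if "v \<in> ?S" for v using that by auto
  have cb: "continuous_on ?S ?b" "continuous_on ?S ?m"
    by (intro continuous_on_inner continuous_on_id linear_continuous_on matrix_vector_mul_bounded_linear)+
  have "continuous_on ?S (\<lambda>v. ?m v / ?b v)"
    using pos nz by (intro continuous_on_divide cb) (auto simp: less_le)
  then obtain p0 where p0: "p0 \<in> ?S" "\<And>v. v \<in> ?S \<Longrightarrow> ?m v / ?b v \<le> ?m p0 / ?b p0"
    using continuous_attains_sup[OF cpt] ne by blast
  define d where "d = ?m p0 / ?b p0"
  define Q where "Q v w = d * (v \<bullet> (B *v w)) - v \<bullet> (M *v w)" for v w
  have Qs: "Q v w = Q w v" for v w
    unfolding Q_def using inner_matrix_sym[OF B, of v w] inner_matrix_sym[OF M, of v w] by simp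
  have Qnn: "Q v v \<ge> 0" if v: "v \<in> W" for v
  proof (cases "v = 0")
    case False
    let ?v = "v /\<^sub>R norm v"
    have "?v \<in> ?S" using v False W by (auto intro: subspace_scale)
    then have "?m ?v / ?b ?v \<le> d" "?b ?v > 0"
      using p0(2)[of ?v] pos[of ?v] False unfolding d_def by auto
    then have "Q ?v ?v \<ge> 0"
      unfolding Q_def by (metis diff_ge_0_iff_ge pos_divide_le_eq)
    then have "(inverse (norm v))\<^sup>2 * Q v v \<ge> 0"
      by (simp add: Q_def matrix_vector_mult_scaleR algebra_simps power2_eq_square)
    then show ?thesis using False by (simp add: zero_le_mult_iff)
  qed (simp add: Q_def)
  have b0: "?b p0 > 0" using pos nz p0(1) by auto
  have Q0: "Q p0 p0 = 0" using b0 by (simp add: Q_def d_def)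
  have Qw: "Q w p0 = 0" if w: "w \<in> W" for w
  proof (rule ccontr)
    assume ne0: "Q w p0 \<noteq> 0"
    \<comment> \<open>A quadratic \<open>2 t b + t\<^sup>2 a\<close> with \<open>b \<noteq> 0\<close> is negative for a small \<open>t\<close> of the sign opposite to \<open>b\<close>.\<close>
    define t where "t = - Q w p0 / (Q w w + 1)"
    have aw: "Q w w \<ge> 0" using Qnn w .
    have "Q (p0 + t *\<^sub>R w) (p0 + t *\<^sub>R w) = 2 * t * Q w p0 + t\<^sup>2 * Q w w"
    proof -
      have "Q (p0 + t *\<^sub>R w) (p0 + t *\<^sub>R w) = Q p0 p0 + t * Q p0 w + t * Q w p0 + t\<^sup>2 * Q w w"
        by (simp add: Q_def matrix_vector_right_distrib matrix_vector_mult_scaleR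
            inner_add_left inner_add_right algebra_simps power2_eq_square)
      then show ?thesis using Q0 Qs[of p0 w] by simp
    qed
    moreover have "Q (p0 + t *\<^sub>R w) (p0 + t *\<^sub>R w) \<ge> 0"
      using w p0 W by (intro Qnn) (auto intro: subspace_add subspace_scale)
    moreover have "2 * t * Q w p0 + t\<^sup>2 * Q w w = - ((Q w p0)\<^sup>2 * (Q w w + 2)) / (Q w w + 1)\<^sup>2"
    proof -
      have "Q w w + 1 \<noteq> 0" using aw by simp
      then show ?thesis unfolding t_def
        by (simp add: divide_simps power2_eq_square) (simp add: algebra_simps)
    qed
    moreover have "(Q w p0)\<^sup>2 * (Q w w + 2) / (Q w w + 1)\<^sup>2 > 0"
      using aw ne0 by simp
    ultimately show False by (simp del: mult_pos_pos)
  qed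
  define p where "p = (1 / sqrt (?b p0)) *\<^sub>R p0"
  have "p \<in> W" using p0 W by (auto simp: p_def intro: subspace_scale)
  moreover have "?b p = 1" using b0 by (simp add: p_def matrix_vector_mult_scaleR)
  moreover have "w \<bullet> (M *v p) = d * (w \<bullet> (B *v p))" if "w \<in> W" for w
    using Qw[OF that] by (simp add: p_def matrix_vector_mult_scaleR Q_def)
  ultimately show ?thesis by blast
qed

text \<open>Each step takes an eigenvector in the \<open>B\<close>-orthogonal complement of the earlier ones. The eigenvector
  equation, known only when tested on that complement, holds on all vectors because the earlier vectors are
  eigenvectors themselves.\<close>

lemma simultaneous_diagonalization_on:
  fixes B M :: "real^'m^'m"
  assumes B: "transpose B = B" and M: "transpose M = M"
    and pos: "\<And>v. v \<noteq> 0 \<Longrightarrow> v \<bullet> (B *v v) > 0"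
    and "finite (S :: 'm set)"
  shows "\<exists>p d. (\<forall>i\<in>S. \<forall>j\<in>S. p i \<bullet> (B *v p j) = (if i = j then 1 else 0)) \<and>
    (\<forall>i\<in>S. M *v p i = d i *\<^sub>R (B *v p i))"
  using assms(4)
proof induction
  case empty
  then show ?case by auto
next
  case (insert a S)
  then obtain p d where on: "\<And>i j. i \<in> S \<Longrightarrow> j \<in> S \<Longrightarrow> p i \<bullet> (B *v p j) = (if i = j then 1 else 0)"
    and eig: "\<And>i. i \<in> S \<Longrightarrow> M *v p i = d i *\<^sub>R (B *v p i)" by blast
  let ?W = "{w. \<forall>i\<in>S. w \<bullet> (B *v p i) = 0}"
  have W: "subspace ?W"
    by (auto simp: subspace_def inner_add_left)
  have "dim ((\<lambda>i. B *v p i) ` S) \<le> card S"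
    using dim_le_card'[of "(\<lambda>i. B *v p i) ` S"] card_image_le[OF insert.hyps(1), of "\<lambda>i. B *v p i"] insert.hyps(1)
    by simp
  also have "card S < card (UNIV :: 'm set)"
    using insert.hyps by (intro psubset_card_mono) auto
  finally have "dim ((\<lambda>i. B *v p i) ` S) < DIM(real^'m)" by simp
  then obtain w0 where w0: "w0 \<noteq> 0" "\<And>y. y \<in> span ((\<lambda>i. B *v p i) ` S) \<Longrightarrow> real_inner_class.orthogonal w0 y"
    using orthogonal_to_subspace_exists by blast
  have "w0 \<in> ?W" using w0(2)[OF span_base] by (auto simp: real_inner_class.orthogonal_def)
  then obtain q e where q: "q \<in> ?W" "q \<bullet> (B *v q) = 1" "\<And>w. w \<in> ?W \<Longrightarrow> w \<bullet> (M *v q) = e * (w \<bullet> (B *v q))"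
    using generalized_eigenvector[OF B M pos W _ w0(1)] by blast
  have pq: "p i \<bullet> (B *v q) = 0" if "i \<in> S" for i
    using q(1) that inner_matrix_sym[OF B, of "p i" q] by auto
  have "v \<bullet> (M *v q) = v \<bullet> (e *\<^sub>R (B *v q))" for v
  proof -
    let ?s = "\<Sum>i\<in>S. (v \<bullet> (B *v p i)) *\<^sub>R p i"
    have "?s \<bullet> (B *v p j) = v \<bullet> (B *v p j)" if "j \<in> S" for j
      using that insert.hyps(1) by (simp add: inner_sum_left on if_distrib[of "(*) _"] cong: if_cong)
    then have "v - ?s \<in> ?W" by (simp add: inner_diff_left)
    then have "(v - ?s) \<bullet> (M *v q) = e * ((v - ?s) \<bullet> (B *v q))" by (rule q(3))
    moreover have "?s \<bullet> (B *v q) = 0" using pq by (simp add: inner_sum_left)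
    moreover have "p i \<bullet> (M *v q) = 0" if "i \<in> S" for i
      using q(1) that inner_matrix_sym[OF M, of "p i" q] by (auto simp: eig)
    then have "?s \<bullet> (M *v q) = 0" by (simp add: inner_sum_left)
    ultimately show ?thesis by (simp add: inner_diff_left)
  qed
  then have Mq: "M *v q = e *\<^sub>R (B *v q)" by (metis vector_eq_ldot)
  show ?case
  proof (intro exI conjI ballI)
    fix i j assume "i \<in> insert a S" "j \<in> insert a S"
    then show "(p(a := q)) i \<bullet> (B *v (p(a := q)) j) = (if i = j then 1 else 0)"
      using q pq on insert.hyps(2) by auto
  next
    fix i assume "i \<in> insert a S"
    then show "M *v (p(a := q)) i = (d(a := e)) i *\<^sub>R (B *v (p(a := q)) i)"
      using eig Mq by auto
  qed
qed

definition replace_row :: "real^'m^'m \<Rightarrow> 'm \<Rightarrow> real^'m \<Rightarrow> real^'m^'m" where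
  "replace_row B k v = (\<chi> i. if i = k then v else B $ i)"

lemma det_replace_row_combination:
  fixes B :: "real^'m^'m"
  shows "det (replace_row B k (c v* B)) = c $ k * det B"
proof -
  have "c v* B = (\<Sum>i\<in>UNIV. c $ i *s row i B)"
    by (simp add: vector_matrix_mult_def Finite_Cartesian_Product.row_def vec_eq_iff sum_component mult.commute)
  then have "replace_row B k (c v* B) = (\<chi> i. if i = k then \<Sum>i\<in>UNIV. c $ i *s row i B else row i B)"
    by (simp add: replace_row_def vec_eq_iff Finite_Cartesian_Product.row_def)
  then show ?thesis by (simp only: cramer_lemma_transpose)
qed

text \<open>The derivative of the determinant at \<open>B\<close> in the direction \<open>M\<close>, that is \<open>det B tr (B\<^sup>-\<^sup>1 M)\<close> for invertible
  \<open>B\<close>. As a sum over rows it is a polynomial in the entries, and each summand can be integrated by parts on its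
  own.\<close>

definition det_variation :: "real^'m^'m \<Rightarrow> real^'m^'m \<Rightarrow> real" where
  "det_variation B M = (\<Sum>k\<in>UNIV. det (replace_row B k (M $ k)))"

lemma det_variation_mult:
  fixes B C :: "real^'m^'m"
  shows "det_variation B (C ** B) = trace C * det B"
proof -
  have "(C ** B) $ k = (C $ k) v* B" for k
    by (simp add: matrix_matrix_mult_def vector_matrix_mult_def vec_eq_iff mult.commute)
  then show ?thesis
    by (simp add: det_variation_def det_replace_row_combination trace_def sum_distrib_right)
qed

text \<open>The \<open>d i\<close> are the eigenvalues of \<open>M\<close> relative to \<open>B\<close>, and the \<open>p i\<close> form a \<open>B\<close>-orthonormal basis of
  eigenvectors.\<close>

lemma det_variation_eigenvalues:
  fixes B M :: "real^'m^'m"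
  assumes B: "transpose B = B" and M: "transpose M = M"
    and pos: "\<And>v. v \<noteq> 0 \<Longrightarrow> v \<bullet> (B *v v) > 0"
  shows "det B > 0 \<and> (\<exists>(p :: 'm \<Rightarrow> real^'m) d. (\<forall>i. d i = p i \<bullet> (M *v p i)) \<and> det M = (\<Prod>i\<in>UNIV. d i) * det B \<and>
    det_variation B M = (\<Sum>i\<in>UNIV. d i) * det B)"
proof -
  obtain p :: "'m \<Rightarrow> real^'m" and d :: "'m \<Rightarrow> real" where on: "\<And>i j. p i \<bullet> (B *v p j) = (if i = j then 1 else 0)"
    and eig: "\<And>i. M *v p i = d i *\<^sub>R (B *v p i)"
    using simultaneous_diagonalization_on[OF B M pos finite[of UNIV]] by force
  define P :: "real^'m^'m" where "P = (\<chi> i j. p j $ i)"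
  define D :: "real^'m^'m" where "D = (\<chi> i j. if i = j then d i else 0)"
  have col: "(A ** P) $ i $ j = (A *v p j) $ i" for A i j
    by (simp add: P_def matrix_matrix_mult_def matrix_vector_mult_def)
  have entry: "(transpose P ** (A ** P)) $ i $ j = p i \<bullet> (A *v p j)" for A i j
  proof -
    have "(transpose P ** (A ** P)) $ i $ j = (\<Sum>k\<in>UNIV. p i $ k * (A ** P) $ k $ j)"
      by (subst matrix_matrix_mult_def) (simp add: P_def Finite_Cartesian_Product.transpose_def)
    then show ?thesis by (simp add: col inner_vec_def)
  qed
  have PBP: "transpose P ** (B ** P) = mat 1"
    unfolding vec_eq_iff entry by (simp add: on Finite_Cartesian_Product.mat_def)
  have BPD: "M ** P = (B ** P) ** D"
    unfolding vec_eq_iff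
  proof (intro allI)
    fix i j
    have "((B ** P) ** D) $ i $ j = (\<Sum>k\<in>UNIV. (B *v p k) $ i * (if k = j then d k else 0))"
      unfolding matrix_matrix_mult_def[of "B ** P"] by (simp add: col D_def)
    also have "\<dots> = (B *v p j) $ i * d j" by (simp add: if_distrib[of "(*) _"] cong: if_cong)
    finally show "(M ** P) $ i $ j = ((B ** P) ** D) $ i $ j"
      by (simp add: col eig)
  qed
  have inv: "(B ** P) ** transpose P = mat 1"
    using PBP matrix_left_right_inverse by blast
  have inv2: "P ** (transpose P ** B) = mat 1"
    using PBP by (metis matrix_left_right_inverse matrix_mul_assoc)
  have detP: "det P * det P * det B = 1"
    using arg_cong[OF PBP, of det] by (simp add: det_mul mult.commute mult.left_commute)
  have "det B > 0"
    using detP mult_nonneg_nonpos[of "det P * det P" "det B"] by (cases "det B > 0") auto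
  moreover have "det M = det D * det B"
  proof -
    have "det M * det P = det B * det P * det D"
      using arg_cong[OF BPD, of det] by (simp add: det_mul)
    then show ?thesis using detP by auto
  qed
  moreover have "det D = (\<Prod>i\<in>UNIV. d i)"
    by (subst det_diagonal) (auto simp: D_def)
  moreover have "det_variation B M = trace D * det B"
  proof -
    let ?C = "((B ** P) ** D) ** transpose P"
    have "M = M ** (P ** (transpose P ** B))" by (simp add: inv2)
    also have "\<dots> = ?C ** B" by (simp add: BPD matrix_mul_assoc)
    finally have "det_variation B M = trace ?C * det B"
      using det_variation_mult[of B ?C] by simp
    also have "trace ?C = trace (transpose P ** ((B ** P) ** D))" by (rule trace_mul_sym)
    also have "transpose P ** ((B ** P) ** D) = D" using PBP by (simp add: matrix_mul_assoc)
    finally show ?thesis .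
  qed
  moreover have "trace D = (\<Sum>i\<in>UNIV. d i)" by (simp add: trace_def D_def)
  moreover have "d i = p i \<bullet> (M *v p i)" for i by (simp add: eig on)
  ultimately show ?thesis by (intro conjI exI[of _ p] exI[of _ d] allI) simp_all
qed

lemma det_pos:
  fixes B :: "real^'m^'m"
  assumes "transpose B = B" "\<And>v. v \<noteq> 0 \<Longrightarrow> v \<bullet> (B *v v) > 0"
  shows "det B > 0"
  using det_variation_eigenvalues[OF assms(1) assms(1) assms(2)] by blast

lemma det_variation_ge:
  fixes B M :: "real^'m^'m"
  assumes B: "transpose B = B" and M: "transpose M = M"
    and pos: "\<And>v. v \<noteq> 0 \<Longrightarrow> v \<bullet> (B *v v) > 0" and Mpos: "\<And>v. v \<bullet> (M *v v) \<ge> 0"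
  shows "det_variation B M \<ge> CARD('m) * (det M / det B) powr (1 / CARD('m)) * det B"
proof -
  obtain p :: "'m \<Rightarrow> real^'m" and d :: "'m \<Rightarrow> real" where Bp: "det B > 0" and d: "\<And>i. d i = p i \<bullet> (M *v p i)" and
    e: "det M = (\<Prod>i\<in>UNIV. d i) * det B" "det_variation B M = (\<Sum>i\<in>UNIV. d i) * det B"
    using det_variation_eigenvalues[OF B M pos] by blast
  have "(\<Prod>i\<in>UNIV. d i) powr (1 / CARD('m)) \<le> (\<Sum>i\<in>UNIV. d i / CARD('m))"
    using arith_geom_mean[of "UNIV :: 'm set" d] Mpos d by auto
  then have "CARD('m) * (\<Prod>i\<in>UNIV. d i) powr (1 / CARD('m)) \<le> (\<Sum>i\<in>UNIV. d i)"
    by (simp add: sum_divide_distrib[symmetric] field_simps)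
  then show ?thesis using Bp by (simp add: e)
qed

lemma det_reindex:
  fixes h :: "'m::finite \<Rightarrow> nat" and G :: "nat \<Rightarrow> nat \<Rightarrow> real"
  assumes h: "bij_betw h UNIV {0..<N}"
  shows "det (\<chi> i j. G (h i) (h j)) = Determinant.det (Matrix.mat N N (\<lambda>(i, j). G i j))"
proof -
  let ?g = "inv_into UNIV h"
  have g: "bij_betw ?g {0..<N} UNIV" using h by (rule bij_betw_inv_into)
  have "det (\<chi> i j. G (h i) (h j)) =
    (\<Sum>p | p permutes (UNIV :: 'm set). of_int (sign p) * (\<Prod>i\<in>UNIV. G (h i) (h (p i))))"
    by (simp add: Determinants.det_def)
  also have "\<dots> = (\<Sum>q | q permutes {0..<N}. of_int (sign q) * (\<Prod>i = 0..<N. G i (q i)))"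
  proof (rule sum.reindex_bij_witness[where j = "map_permutation UNIV h" and i = "map_permutation {0..<N} ?g"])
    fix p :: "'m \<Rightarrow> 'm" assume "p \<in> {p. p permutes UNIV}"
    then have p: "p permutes UNIV" by simp
    have inj: "inj_on h UNIV" using h by (simp add: bij_betw_def)
    show "map_permutation {0..<N} ?g (map_permutation UNIV h p) = p"
      using map_permutation_compose_inv[OF h p] inj by simp
    show "map_permutation UNIV h p \<in> {q. q permutes {0..<N}}"
      using map_permutation_permutes[OF h p] by simp
    have "(\<Prod>i = 0..<N. G i (map_permutation UNIV h p i)) =
        (\<Prod>i\<in>UNIV. G (h i) (map_permutation UNIV h p (h i)))"
      by (rule prod.reindex_bij_betw[OF h, symmetric])
    also have "\<dots> = (\<Prod>i\<in>UNIV. G (h i) (h (p i)))"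
      using inj by (simp add: map_permutation_apply)
    finally show "of_int (sign (map_permutation UNIV h p)) * (\<Prod>i = 0..<N. G i (map_permutation UNIV h p i)) =
      of_int (sign p) * (\<Prod>i\<in>UNIV. G (h i) (h (p i)))"
      using sign_map_permutation[OF inj p] by simp
  next
    fix q :: "nat \<Rightarrow> nat" assume "q \<in> {q. q permutes {0..<N}}"
    then have q: "q permutes {0..<N}" by simp
    show "map_permutation {0..<N} ?g q \<in> {p. p permutes UNIV}"
      using map_permutation_permutes[OF g q] by simp
    show "map_permutation UNIV h (map_permutation {0..<N} ?g q) = q"
      using h by (intro map_permutation_compose_inv[OF g q]) (auto simp: bij_betw_def f_inv_into_f)
  qed
  finally show ?thesis by (simp add: Determinant.det_def)
qed

text \<open>With respect to an orthonormal frame completed by \<open>x\<close>, only the rank one term contributes to the last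
  row and column. Since its corner entry is a multiple of \<open>(w \<bullet> x)\<^sup>2\<close>, subtracting multiples of the last row
  removes the rank one term from the tangential block.\<close>

lemma det_rank_one_perturbation:
  fixes M :: "real^'m^'m" and x w :: "real^'m"
  assumes M: "transpose M = M" and Mx: "M *v x = 0" and x: "norm x = 1" and w: "w \<bullet> x \<noteq> 0"
  shows "det (\<chi> i j. M $ i $ j + l * (w $ i * w $ j)) = l * (w \<bullet> x)\<^sup>2 * frame_det x (\<lambda>v w. v \<bullet> (M *v w))"
proof -
  let ?n = "CARD('m) - 1" and ?N = "CARD('m)"
  define e where "e = (SOME e. orthonormal_frame x e)"
  have e: "orthonormal_frame x e"
    using someI_ex[OF orthonormal_frame_exists[of x]] x by (simp add: e_def)
  have on: "e i \<bullet> e j = (if i = j then 1 else 0)" if "i < ?n" "j < ?n" for i j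
    using e that by (auto simp: orthonormal_frame_def)
  have ex: "e i \<bullet> x = 0" if "i < ?n" for i
    using e that by (auto simp: orthonormal_frame_def tangent_space_def)
  have xx: "x \<bullet> x = 1" using x by (simp add: norm_eq_1)
  have N: "?N = ?n + 1" by (simp add: Suc_leI)
  define b where "b i = (if i < ?n then e i else x)" for i
  have bb: "b i \<bullet> b j = (if i = j then 1 else 0)" if "i < ?N" "j < ?N" for i j
    using on ex xx that N by (auto simp: b_def inner_commute)
  obtain h :: "'m \<Rightarrow> nat" where h: "bij_betw h UNIV {0..<?N}"
    using ex_bij_betw_finite_nat[of "UNIV :: 'm set"] by auto
  have hlt: "h i < ?N" for i using h by (auto simp: bij_betw_def)
  have hinj: "h i = h j \<longleftrightarrow> i = j" for i j using h by (auto simp: bij_betw_def inj_on_def)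
  define Q :: "real^'m^'m" where "Q = (\<chi> i. b (h i))"
  have sand: "(Q ** (A ** transpose Q)) $ i $ j = b (h i) \<bullet> (A *v b (h j))" for A :: "real^'m^'m" and i j
  proof -
    have "(A ** transpose Q) $ k $ j = (A *v b (h j)) $ k" for k
      by (simp add: matrix_matrix_mult_def matrix_vector_mult_def Q_def Finite_Cartesian_Product.transpose_def)
    moreover have "(Q ** (A ** transpose Q)) $ i $ j = (\<Sum>k\<in>UNIV. b (h i) $ k * (A ** transpose Q) $ k $ j)"
      by (subst matrix_matrix_mult_def) (simp add: Q_def)
    ultimately show ?thesis by (simp add: inner_vec_def)
  qed
  have "Q ** (mat 1 ** transpose Q) = mat 1"
    unfolding vec_eq_iff sand matrix_vector_mul_lid by (simp add: bb hlt hinj Finite_Cartesian_Product.mat_def)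
  from arg_cong[OF this, of det] have dQ: "det Q * det Q = 1" by (simp add: det_mul)
  let ?P = "\<chi> i j. M $ i $ j + l * (w $ i * w $ j)"
  have Pv: "?P *v v = M *v v + (l * (w \<bullet> v)) *\<^sub>R w" for v
    by (simp add: vec_eq_iff matrix_vector_mult_def inner_vec_def algebra_simps sum.distrib sum_distrib_left)
  have xM: "x \<bullet> (M *v v) = 0" for v using inner_matrix_sym[OF M, of x v] Mx by simp
  define G where "G i j = b i \<bullet> (M *v b j) + l * (w \<bullet> b i) * (w \<bullet> b j)" for i j
  have "det ?P = det (Q ** (?P ** transpose Q))"
    using dQ by (simp add: det_mul)
  also have "Q ** (?P ** transpose Q) = (\<chi> i j. G (h i) (h j))"
    unfolding vec_eq_iff sand Pv by (simp add: G_def inner_add_right inner_commute)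
  also have "det \<dots> = Determinant.det (Matrix.mat ?N ?N (\<lambda>(i, j). G i j))"
    by (rule det_reindex[OF h])
  also have "\<dots> = l * (w \<bullet> x)\<^sup>2 * Determinant.det (frame_matrix e (\<lambda>v w. v \<bullet> (M *v w)))"
  proof -
    let ?A = "frame_matrix e (\<lambda>v w. v \<bullet> (M *v w))"
    define c where "c = w \<bullet> x"
    define a where "a = Matrix.mat ?n 1 (\<lambda>(i, j). (w \<bullet> e i) / c)"
    define r where "r = Matrix.mat 1 ?n (\<lambda>(i, j). l * c * (w \<bullet> e j))"
    define s where "s = Matrix.mat 1 1 (\<lambda>(i, j). l * c\<^sup>2)"
    have A: "?A \<in> carrier_mat ?n ?n" by (simp add: frame_matrix_def)
    have a: "a \<in> carrier_mat ?n 1" and r: "r \<in> carrier_mat 1 ?n" and s: "s \<in> carrier_mat 1 1"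
      by (simp_all add: a_def r_def s_def)
    \<comment> \<open>The unipotent left factor adds the multiples of the last row that make up the upper right block.\<close>
    let ?U = "four_block_mat (1\<^sub>m ?n) a (0\<^sub>m 1 ?n) (1\<^sub>m 1)"
    let ?L = "four_block_mat ?A (0\<^sub>m ?n 1) r s"
    have E: "Matrix.mat ?N ?N (\<lambda>(i, j). G i j) = ?U * ?L"
    proof -
      have "?U * ?L = four_block_mat (1\<^sub>m ?n * ?A + a * r) (1\<^sub>m ?n * 0\<^sub>m ?n 1 + a * s)
          (0\<^sub>m 1 ?n * ?A + 1\<^sub>m 1 * r) (0\<^sub>m 1 ?n * 0\<^sub>m ?n 1 + 1\<^sub>m 1 * s)"
        by (rule mult_four_block_mat[OF one_carrier_mat a zero_carrier_mat one_carrier_mat A zero_carrier_mat r s])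
      also have "\<dots> = four_block_mat (?A + a * r) (a * s) r s"
      proof -
        have "1\<^sub>m ?n * ?A = ?A" "1\<^sub>m 1 * r = r" "1\<^sub>m 1 * s = s" "0\<^sub>m 1 ?n * ?A = 0\<^sub>m 1 ?n"
          using left_mult_one_mat[OF A] left_mult_one_mat[OF r] left_mult_one_mat[OF s] left_mult_zero_mat[OF A] by blast+
        moreover have "1\<^sub>m ?n * 0\<^sub>m ?n 1 + a * s = a * s" "0\<^sub>m 1 ?n + r = r" "0\<^sub>m 1 ?n * 0\<^sub>m ?n 1 + s = s"
          using mult_carrier_mat[OF a s] r s by (simp_all add: left_add_zero_mat)
        ultimately show ?thesis by (simp only:)
      qed
      also have "\<dots> = Matrix.mat ?N ?N (\<lambda>(i, j). G i j)"
      proof (rule eq_matI)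
        fix i j assume "i < dim_row (Matrix.mat ?N ?N (\<lambda>(i, j). G i j))"
          "j < dim_col (Matrix.mat ?N ?N (\<lambda>(i, j). G i j))"
        then have ij: "i < ?n + 1" "j < ?n + 1" using N by simp_all
        show "four_block_mat (?A + a * r) (a * s) r s $$ (i, j) = Matrix.mat ?N ?N (\<lambda>(i, j). G i j) $$ (i, j)"
        proof -
          have iN: "i < ?N" "j < ?N" using ij N by linarith+
          note simps = iN w xM Mx G_def b_def frame_matrix_def a_def r_def s_def scalar_prod_def c_def power2_eq_square
          consider "i < ?n" "j < ?n" | "i < ?n" "j = ?n" | "i = ?n" "j < ?n" | "i = ?n" "j = ?n"
            using ij by linarith
          then show ?thesis by cases (simp_all add: simps del: One_nat_def)
        qed
      qed (use carrier_matD[OF a] carrier_matD[OF A] carrier_matD[OF r] carrier_matD[OF s] in \<open>auto simp: N[symmetric]\<close>)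
      finally show ?thesis ..
    qed
    have dU: "Determinant.det ?U = 1"
      using det_four_block_mat_lower_left_zero[of "1\<^sub>m ?n" ?n a 1 "0\<^sub>m 1 ?n" "1\<^sub>m 1"] a
      by (simp only: det_one one_carrier_mat mult_1)
    have dL: "Determinant.det ?L = Determinant.det ?A * (l * c\<^sup>2)"
    proof -
      have "Determinant.det s = l * c\<^sup>2" using det_single[OF s] by (simp add: s_def)
      then show ?thesis using det_four_block_mat_upper_right_zero[OF A refl r s] by (simp only:)
    qed
    have dUL: "Determinant.det (?U * ?L) = Determinant.det ?U * Determinant.det ?L"
      by (rule det_mult[OF four_block_carrier_mat[OF one_carrier_mat one_carrier_mat] four_block_carrier_mat[OF A s]])
    show ?thesis unfolding E dUL dU dL c_def mult_1 by (rule mult.commute)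
  qed
  finally show ?thesis by (simp add: frame_det_def e_def)
qed

section \<open>Cofactors of a Hessian are divergence free\<close>

lemma linear_det_replace_row:
  fixes B :: "real^'m^'m"
  shows "linear (\<lambda>v. det (replace_row B k v))"
  unfolding replace_row_def
proof (rule linearI)
  fix u v :: "real^'m" and c :: real
  show "det (\<chi> i. if i = k then u + v else B $ i) = det (\<chi> i. if i = k then u else B $ i) + det (\<chi> i. if i = k then v else B $ i)"
    using Determinants.det_row_add[of k "\<lambda>_. u" "\<lambda>_. v" "\<lambda>i. B $ i"] by simp
  show "det (\<chi> i. if i = k then c *\<^sub>R u else B $ i) = c *\<^sub>R det (\<chi> i. if i = k then u else B $ i)"
    using Determinants.det_row_mul[of k c "\<lambda>_. u" "\<lambda>i. B $ i"] unfolding scalar_mult_eq_scaleR by simp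
qed

lemma replace_row_same: "replace_row (replace_row B k u) k v = replace_row B k v"
  by (simp add: replace_row_def vec_eq_iff)

lemma replace_row_swap: "a \<noteq> k \<Longrightarrow> replace_row (replace_row B k u) a v = replace_row (replace_row B a v) k u"
  by (auto simp: replace_row_def vec_eq_iff)

lemma det_replace_two_rows_antisym:
  fixes B :: "real^'m^'m"
  assumes "a \<noteq> k"
  shows "det (replace_row (replace_row B k u) a v) = - det (replace_row (replace_row B k v) a u)"
proof -
  let ?E = "\<lambda>u v. det (replace_row (replace_row B k u) a v)"
  have alt: "?E w w = 0" for w
    using assms by (intro Determinants.det_identical_rows[of k a])
      (auto simp: replace_row_def Finite_Cartesian_Product.row_def vec_eq_iff)
  have right: "?E w (u + v) = ?E w u + ?E w v" for w u v
    using linear_add[OF linear_det_replace_row] .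
  have left: "?E (u + v) w = ?E u w + ?E v w" for w u v
    unfolding replace_row_swap[OF assms] using linear_add[OF linear_det_replace_row] .
  have "?E (u + v) (u + v) = 0" by (rule alt)
  then show ?thesis using alt[of u] alt[of v] by (simp add: left right)
qed

lemma has_derivative_det:
  fixes A :: "'a::real_normed_vector \<Rightarrow> real^'m^'m"
  assumes D: "\<And>a b. ((\<lambda>x. A x $ a $ b) has_derivative D a b) (at x)"
  shows "((\<lambda>x. det (A x)) has_derivative
    (\<lambda>v. \<Sum>a\<in>UNIV. det (replace_row (A x) a (\<chi> b. D a b v)))) (at x)"
proof -
  have "((\<lambda>x. det (A x)) has_derivative (\<lambda>v. \<Sum>p | p permutes (UNIV :: 'm set). of_int (sign p) *
      (\<Sum>a\<in>UNIV. D a (p a) v * (\<Prod>j\<in>UNIV - {a}. A x $ j $ p j)))) (at x)"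
    unfolding Determinants.det_def
    by (intro has_derivative_sum has_derivative_mult_right has_derivative_prod D)
  also have "(\<lambda>v. \<Sum>p | p permutes (UNIV :: 'm set). of_int (sign p) *
      (\<Sum>a\<in>UNIV. D a (p a) v * (\<Prod>j\<in>UNIV - {a}. A x $ j $ p j))) =
      (\<lambda>v. \<Sum>a\<in>UNIV. det (replace_row (A x) a (\<chi> b. D a b v)))"
  proof
    fix v
    have "det (replace_row (A x) a (\<chi> b. D a b v)) = (\<Sum>p | p permutes (UNIV :: 'm set). of_int (sign p) *
      (D a (p a) v * (\<Prod>j\<in>UNIV - {a}. A x $ j $ p j)))" for a
    proof -
      have "(\<Prod>j\<in>UNIV. replace_row (A x) a (\<chi> b. D a b v) $ j $ p j) =
          D a (p a) v * (\<Prod>j\<in>UNIV - {a}. A x $ j $ p j)" for p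
        by (subst prod.remove[of UNIV a]) (auto simp: replace_row_def intro!: prod.cong)
      then show ?thesis by (simp add: Determinants.det_def)
    qed
    then show "(\<Sum>p | p permutes (UNIV :: 'm set). of_int (sign p) *
      (\<Sum>a\<in>UNIV. D a (p a) v * (\<Prod>j\<in>UNIV - {a}. A x $ j $ p j))) =
      (\<Sum>a\<in>UNIV. det (replace_row (A x) a (\<chi> b. D a b v)))"
      by (simp only: sum_distrib_left) (rule sum.swap)
  qed
  finally show ?thesis .
qed

lemma C_k_on_det:
  fixes A :: "'a::real_normed_vector \<Rightarrow> real^'m^'m"
  assumes "open U" "\<And>a b. C_k_on k (\<lambda>x. A x $ a $ b) U"
  shows "C_k_on k (\<lambda>x. det (A x)) U"
  unfolding Determinants.det_def
  by (intro C_k_on_sum C_k_on_mult C_k_on_prod C_k_on_const assms)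

text \<open>The condition \<open>curl\<close> says that the rows of \<open>A\<close> are gradients to first order at \<open>x\<close>. Differentiating a row
  \<open>a \<noteq> k\<close> pairs the derivatives of that row, symmetric in \<open>i\<close> and \<open>b\<close>, with a determinant that changes sign when
  \<open>i\<close> and \<open>b\<close> are exchanged; so only the derivative of \<open>\<zeta>\<close> survives.\<close>

lemma cofactor_divergence:
  fixes A :: "real^'m \<Rightarrow> real^'m^'m" and \<zeta> :: "real^'m \<Rightarrow> real"
  assumes A: "\<And>a b. (\<lambda>x. A x $ a $ b) differentiable (at x)" and \<zeta>: "\<zeta> differentiable (at x)"
    and curl: "\<And>a b i. pd i (\<lambda>x. A x $ a $ b) x = pd b (\<lambda>x. A x $ a $ i) x"
  shows "(\<Sum>i\<in>UNIV. pd i (\<lambda>x. det (replace_row (A x) k (\<zeta> x *\<^sub>R axis i 1))) x) =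
    det (replace_row (A x) k (\<chi> i. pd i \<zeta> x))"
proof -
  let ?dA = "\<lambda>i a. \<chi> b. pd i (\<lambda>x. A x $ a $ b) x"
  let ?E = "\<lambda>a u v. det (replace_row (replace_row (A x) k u) a v)"
  have A': "((\<lambda>x. A x $ a $ b) has_derivative frechet_derivative (\<lambda>x. A x $ a $ b) (at x)) (at x)" for a b
    using A frechet_derivative_works by blast
  have \<zeta>': "(\<zeta> has_derivative frechet_derivative \<zeta> (at x)) (at x)"
    using \<zeta> frechet_derivative_works by blast
  have each: "pd i (\<lambda>x. det (replace_row (A x) k (\<zeta> x *\<^sub>R axis i 1))) x =
      pd i \<zeta> x * det (replace_row (A x) k (axis i 1)) +
      \<zeta> x * (\<Sum>a\<in>UNIV - {k}. \<Sum>b\<in>UNIV. pd i (\<lambda>x. A x $ a $ b) x * ?E a (axis i 1) (axis b 1))" for i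
  proof -
    let ?D = "\<lambda>a b v. if a = k then frechet_derivative \<zeta> (at x) v * axis i 1 $ b
        else frechet_derivative (\<lambda>x. A x $ a $ b) (at x) v"
    have "((\<lambda>x. replace_row (A x) k (\<zeta> x *\<^sub>R axis i 1) $ a $ b) has_derivative ?D a b) (at x)" for a b
      using A'[of a b] has_derivative_mult_left[OF \<zeta>', of "axis i 1 $ b"] by (cases "a = k") (simp_all add: replace_row_def)
    from pd_eqI[OF has_derivative_det[OF this], of i]
    have "pd i (\<lambda>x. det (replace_row (A x) k (\<zeta> x *\<^sub>R axis i 1))) x =
      (\<Sum>a\<in>UNIV. ?E a (\<zeta> x *\<^sub>R axis i 1) (\<chi> b. ?D a b (axis i 1)))" .
    also have "\<dots> = ?E k (\<zeta> x *\<^sub>R axis i 1) (pd i \<zeta> x *\<^sub>R axis i 1) +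
      (\<Sum>a\<in>UNIV - {k}. ?E a (\<zeta> x *\<^sub>R axis i 1) (?dA i a))"
    proof -
      have "(\<chi> b. ?D k b (axis i 1)) = pd i \<zeta> x *\<^sub>R axis i 1"
        by (simp add: vec_eq_iff pd_def)
      moreover have "(\<chi> b. ?D a b (axis i 1)) = ?dA i a" if "a \<noteq> k" for a
        using that by (simp add: vec_eq_iff pd_def)
      ultimately show ?thesis by (simp add: sum.remove[of UNIV k])
    qed
    also have "?E k (\<zeta> x *\<^sub>R axis i 1) (pd i \<zeta> x *\<^sub>R axis i 1) = pd i \<zeta> x * det (replace_row (A x) k (axis i 1))"
      by (simp add: replace_row_same linear_cmul[OF linear_det_replace_row])
    also have "(\<Sum>a\<in>UNIV - {k}. ?E a (\<zeta> x *\<^sub>R axis i 1) (?dA i a)) =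
      \<zeta> x * (\<Sum>a\<in>UNIV - {k}. \<Sum>b\<in>UNIV. pd i (\<lambda>x. A x $ a $ b) x * ?E a (axis i 1) (axis b 1))"
      unfolding sum_distrib_left
    proof (rule sum.cong[OF refl])
      fix a assume "a \<in> UNIV - {k}"
      then have ak: "a \<noteq> k" by simp
      have "?E a (\<zeta> x *\<^sub>R axis i 1) (?dA i a) = \<zeta> x * ?E a (axis i 1) (?dA i a)"
        unfolding replace_row_swap[OF ak] by (simp add: linear_cmul[OF linear_det_replace_row])
      also have "?E a (axis i 1) (?dA i a) = (\<Sum>b\<in>UNIV. pd i (\<lambda>x. A x $ a $ b) x * ?E a (axis i 1) (axis b 1))"
        by (subst vec_basis_sum[of "?dA i a"])
          (simp add: linear_sum[OF linear_det_replace_row] linear_cmul[OF linear_det_replace_row])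
      finally show "?E a (\<zeta> x *\<^sub>R axis i 1) (?dA i a) =
        (\<Sum>b\<in>UNIV. \<zeta> x * (pd i (\<lambda>x. A x $ a $ b) x * ?E a (axis i 1) (axis b 1)))"
        by (simp add: sum_distrib_left)
    qed
    finally show ?thesis .
  qed
  have "(\<Sum>i\<in>UNIV. \<Sum>a\<in>UNIV - {k}. \<Sum>b\<in>UNIV. pd i (\<lambda>x. A x $ a $ b) x * ?E a (axis i 1) (axis b 1)) =
    (\<Sum>a\<in>UNIV - {k}. \<Sum>i\<in>UNIV. \<Sum>b\<in>UNIV. pd i (\<lambda>x. A x $ a $ b) x * ?E a (axis i 1) (axis b 1))"
    by (rule sum.swap)
  also have "\<dots> = 0"
  proof (rule sum.neutral, rule ballI)
    fix a assume "a \<in> UNIV - {k}"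
    then have ak: "a \<noteq> k" by simp
    let ?S = "\<Sum>i\<in>UNIV. \<Sum>b\<in>UNIV. pd i (\<lambda>x. A x $ a $ b) x * ?E a (axis i 1) (axis b 1)"
    have "?S = (\<Sum>b\<in>UNIV. \<Sum>i\<in>UNIV. pd i (\<lambda>x. A x $ a $ b) x * ?E a (axis i 1) (axis b 1))"
      by (rule sum.swap)
    also have "\<dots> = (\<Sum>b\<in>UNIV. \<Sum>i\<in>UNIV. - (pd b (\<lambda>x. A x $ a $ i) x * ?E a (axis b 1) (axis i 1)))"
      by (intro sum.cong refl) (subst curl, subst det_replace_two_rows_antisym[OF ak], simp)
    also have "\<dots> = - ?S" by (simp add: sum_negf)
    finally show "?S = 0" by simp
  qed
  finally have z: "(\<Sum>i\<in>UNIV. \<zeta> x * (\<Sum>a\<in>UNIV - {k}. \<Sum>b\<in>UNIV. pd i (\<lambda>x. A x $ a $ b) x * ?E a (axis i 1) (axis b 1))) = 0"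
    by (simp flip: sum_distrib_left)
  have "det (replace_row (A x) k (\<chi> i. pd i \<zeta> x)) = (\<Sum>i\<in>UNIV. pd i \<zeta> x * det (replace_row (A x) k (axis i 1)))"
    by (subst vec_basis_sum[of "\<chi> i. pd i \<zeta> x"])
      (simp add: linear_sum[OF linear_det_replace_row] linear_cmul[OF linear_det_replace_row])
  then show ?thesis unfolding each sum.distrib z by simp
qed

lemma integral_det_replace_row_gradient:
  fixes A :: "real^'m \<Rightarrow> real^'m^'m" and \<zeta> :: "real^'m \<Rightarrow> real"
  assumes A: "\<And>a b. C_k_on 1 (\<lambda>x. A x $ a $ b) (- {0})" and \<zeta>: "C_k_on 1 \<zeta> (- {0})" "annular \<zeta>"
    and curl: "\<And>x a b i. x \<noteq> 0 \<Longrightarrow> pd i (\<lambda>x. A x $ a $ b) x = pd b (\<lambda>x. A x $ a $ i) x"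
  shows "(\<integral>x. det (replace_row (A x) k (\<chi> i. pd i \<zeta> x)) \<partial>lborel) = 0"
proof -
  let ?V = "\<lambda>i x. det (replace_row (A x) k (\<zeta> x *\<^sub>R axis i 1))"
  have V0: "?V i x = 0" if "\<zeta> x = 0" for i x
    using that linear_0[OF linear_det_replace_row[of "A x" k]] by simp
  have "(\<integral>x. (\<Sum>i\<in>UNIV. pd i (?V i) x) \<partial>lborel) = 0"
  proof (rule integral_divergence_annular)
    fix i
    have o: "open (- {0 :: real^'m})" by auto
    have "C_k_on 1 (\<lambda>x. replace_row (A x) k (\<zeta> x *\<^sub>R axis i 1) $ a $ b) (- {0})" for a b
      using A[of a b] C_k_on_mult[OF o \<zeta>(1) C_k_on_const[OF o], of "axis i 1 $ b"]
      by (cases "a = k") (simp_all add: replace_row_def del: C_k_on.simps One_nat_def)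
    then show "C_k_on 1 (?V i) (- {0})" by (rule C_k_on_det[rotated]) auto
    show "annular (?V i)" using \<zeta>(2) V0 by (rule annular_weaken)
  qed
  also have "(\<integral>x. (\<Sum>i\<in>UNIV. pd i (?V i) x) \<partial>lborel) = (\<integral>x. det (replace_row (A x) k (\<chi> i. pd i \<zeta> x)) \<partial>lborel)"
  proof (rule Bochner_Integration.integral_cong[OF refl])
    fix x :: "real^'m"
    show "(\<Sum>i\<in>UNIV. pd i (?V i) x) = det (replace_row (A x) k (\<chi> i. pd i \<zeta> x))"
    proof (cases "x = 0")
      case False
      show ?thesis
      proof (rule cofactor_divergence)
        show "(\<lambda>x. A x $ a $ b) differentiable (at x)" for a b
          using A[of a b] False by simp
        show "\<zeta> differentiable (at x)" using \<zeta>(1) False by simp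
        show "pd i (\<lambda>x. A x $ a $ b) x = pd b (\<lambda>x. A x $ a $ i) x" for a b i
          using False by (rule curl)
      qed
    next
      case True
      obtain a where a: "a > 0" "\<And>y. norm y < a \<Longrightarrow> \<zeta> y = 0"
        using \<zeta>(2) unfolding annular_def by blast
      have z: "pd i g x = 0" if "\<And>y. \<zeta> y = 0 \<Longrightarrow> g y = 0" for i g
      proof -
        have "pd i g x = pd i (\<lambda>_. 0) x"
          using a True that by (intro pd_cong[of "ball 0 a"]) auto
        then show ?thesis by (simp add: pd_eqI[OF has_derivative_const])
      qed
      have "pd i (?V i) x = 0" for i by (rule z) (rule V0)
      moreover have "pd i \<zeta> x = 0" for i by (rule z)
      moreover have "(\<chi> i. 0) = (0 :: real^'m)" by (simp add: vec_eq_iff)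
      ultimately show ?thesis using linear_0[OF linear_det_replace_row[of "A x" k]] by simp
    qed
  qed
  finally show ?thesis .
qed

section \<open>Homogeneous functions and gauges\<close>

lemma pd_mult:
  fixes f g :: "real^'m \<Rightarrow> real"
  assumes "f differentiable (at x)" "g differentiable (at x)"
  shows "pd i (\<lambda>x. f x * g x) x = f x * pd i g x + pd i f x * g x"
  using pd_eqI[OF has_derivative_mult[OF assms[unfolded frechet_derivative_works]]] by (simp add: pd_def)

lemma pd_minus:
  fixes f g :: "real^'m \<Rightarrow> real"
  assumes "f differentiable (at x)" "g differentiable (at x)"
  shows "pd i (\<lambda>x. f x - g x) x = pd i f x - pd i g x"
  using pd_eqI[OF has_derivative_diff[OF assms[unfolded frechet_derivative_works]]] by (simp add: pd_def)

lemma pd_compose: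
  fixes f :: "real^'m \<Rightarrow> real"
  assumes "(h has_real_derivative d) (at (f x))" "f differentiable (at x)"
  shows "pd i (\<lambda>x. h (f x)) x = d * pd i f x"
  using pd_eqI[OF has_derivative_compose[OF assms(2)[unfolded frechet_derivative_works] assms(1)[unfolded has_field_derivative_def]]]
  by (simp add: pd_def)

lemma pd_component: "pd i (\<lambda>x. x $ j) (x :: real^'m) = (if i = j then 1 else 0)"
proof -
  have "pd i (\<lambda>x. x $ j) x = axis i 1 $ j"
    by (rule pd_eqI[OF bounded_linear_imp_has_derivative[OF bounded_linear_vec_nth]])
  then show ?thesis by (simp add: axis_def)
qed

definition homogeneous :: "real \<Rightarrow> ('a::real_vector \<Rightarrow> real) \<Rightarrow> bool" where
  "homogeneous d f \<longleftrightarrow> (\<forall>x t. x \<noteq> 0 \<longrightarrow> t > 0 \<longrightarrow> f (t *\<^sub>R x) = t powr d * f x)"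

lemma homogeneousD: "homogeneous d f \<Longrightarrow> x \<noteq> 0 \<Longrightarrow> t > 0 \<Longrightarrow> f (t *\<^sub>R x) = t powr d * f x"
  unfolding homogeneous_def by blast

lemma homogeneous_pd:
  fixes f :: "real^'m \<Rightarrow> real"
  assumes f: "homogeneous d f" and df: "\<And>x. x \<noteq> 0 \<Longrightarrow> f differentiable (at x)"
  shows "homogeneous (d - 1) (pd i f)"
  unfolding homogeneous_def
proof (intro allI impI)
  fix x :: "real^'m" and t :: real assume x: "x \<noteq> 0" and t: "t > 0"
  have D: "(f has_derivative frechet_derivative f (at (t *\<^sub>R x))) (at (t *\<^sub>R x))"
    using df[of "t *\<^sub>R x"] x t frechet_derivative_works by auto
  have "((\<lambda>y. t *\<^sub>R y) has_derivative (\<lambda>v. t *\<^sub>R v)) (at x)"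
    by (intro bounded_linear_imp_has_derivative bounded_linear_scaleR_right)
  then have "((\<lambda>y. f (t *\<^sub>R y)) has_derivative (\<lambda>v. frechet_derivative f (at (t *\<^sub>R x)) (t *\<^sub>R v))) (at x)"
    using has_derivative_compose D by blast
  then have "pd i (\<lambda>y. f (t *\<^sub>R y)) x = t * pd i f (t *\<^sub>R x)"
    using pd_eqI linear_cmul[OF has_derivative_linear[OF D]] by (fastforce simp: pd_def)
  moreover have "pd i (\<lambda>y. f (t *\<^sub>R y)) x = pd i (\<lambda>y. t powr d * f y) x"
    using x t f by (intro pd_cong[of "- {0}"]) (auto simp: homogeneousD)
  moreover have "pd i (\<lambda>y. t powr d * f y) x = t powr d * pd i f x"
    using pd_mult[of "\<lambda>_. t powr d" x f i] df[OF x] by (simp add: pd_eqI[OF has_derivative_const])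
  ultimately have "t * pd i f (t *\<^sub>R x) = t powr d * pd i f x" by simp
  then show "pd i f (t *\<^sub>R x) = t powr (d - 1) * pd i f x"
    using t by (simp add: powr_diff field_simps)
qed

lemma euler_homogeneous:
  fixes f :: "real^'m \<Rightarrow> real"
  assumes f: "homogeneous d f" and df: "f differentiable (at x)" and x: "x \<noteq> 0"
  shows "(\<Sum>i\<in>UNIV. x $ i * pd i f x) = d * f x"
proof -
  have "((\<lambda>t. t *\<^sub>R x) has_derivative (\<lambda>h. h *\<^sub>R x)) (at 1)"
    by (intro bounded_linear_imp_has_derivative bounded_linear_scaleR_left)
  moreover have "(f has_derivative (\<lambda>v. \<Sum>i\<in>UNIV. v $ i * pd i f x)) (at (1 *\<^sub>R x))"
    using has_derivative_pd[OF df] by simp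
  ultimately have 1: "((\<lambda>t. f (t *\<^sub>R x)) has_derivative (\<lambda>h. \<Sum>i\<in>UNIV. (h *\<^sub>R x) $ i * pd i f x)) (at 1)"
    by (rule has_derivative_compose)
  have "((\<lambda>t. t powr d * f x) has_real_derivative (d * 1 powr (d - 1)) * f x) (at 1)"
    by (auto intro!: derivative_eq_intros)
  then have "((\<lambda>t. t powr d * f x) has_derivative (\<lambda>h. d * f x * h)) (at 1)"
    by (simp add: has_field_derivative_def)
  then have "((\<lambda>t. f (t *\<^sub>R x)) has_derivative (\<lambda>h. d * f x * h)) (at 1)"
    using f x by (rule_tac has_derivative_transform_within_open[of _ _ _ _ "{0<..}"]) (auto simp: homogeneousD)
  from has_derivative_unique[OF 1 this] have "(\<Sum>i\<in>UNIV. (1 *\<^sub>R x) $ i * pd i f x) = d * f x * 1"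
    by metis
  then show ?thesis by simp
qed

definition grad :: "(real^'m \<Rightarrow> real) \<Rightarrow> real^'m \<Rightarrow> real^'m" where
  "grad f x = (\<chi> i. pd i f x)"

definition hess :: "(real^'m \<Rightarrow> real) \<Rightarrow> real^'m \<Rightarrow> real^'m^'m" where
  "hess f x = (\<chi> i j. pd j (pd i f) x)"

text \<open>The Hessian of \<open>f\<^sup>2 / 2\<close>. For homogeneous \<open>f\<close> of degree one, \<open>hess f x\<close> annihilates \<open>x\<close>, whereas this
  matrix is positive definite if \<open>f x > 0\<close> and \<open>hess f x\<close> is so on the complement of \<open>x\<close>.\<close>

definition hess_half_square :: "(real^'m \<Rightarrow> real) \<Rightarrow> real^'m \<Rightarrow> real^'m^'m" where
  "hess_half_square f x = (\<chi> i j. f x * pd j (pd i f) x + pd i f x * pd j f x)"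

locale smooth_homogeneous =
  fixes H :: "real^'m \<Rightarrow> real"
  assumes C3: "C_k_on 3 H (- {0})"
    and homog: "homogeneous 1 H"
begin

lemma C2: "C_k_on 2 (pd i H) (- {0})"
  using C3 C_k_on_pd[of 2 H] by (simp add: eval_nat_numeral del: C_k_on.simps)

lemma C1: "C_k_on 1 (pd j (pd i H)) (- {0})"
  using C2 C_k_on_pd[of 1 "pd i H"] by (simp add: eval_nat_numeral del: C_k_on.simps)

lemma differentiable:
  assumes "x \<noteq> 0"
  shows "H differentiable (at x)" "pd i H differentiable (at x)" "pd j (pd i H) differentiable (at x)"
  using C3 C2[of i] C1[of j i] assms by (auto simp: eval_nat_numeral)

lemma hess_sym: "x \<noteq> 0 \<Longrightarrow> transpose (hess H x) = hess H x"
  using pd_commute[OF C_k_on_mono[OF C3, of 2], of x]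
  by (auto simp: hess_def Finite_Cartesian_Product.transpose_def vec_eq_iff)

lemma grad_dot: "x \<noteq> 0 \<Longrightarrow> grad H x \<bullet> x = H x"
  using euler_homogeneous[OF homog differentiable(1)] by (simp add: grad_def inner_vec_def mult.commute)

lemma hess_radial: "x \<noteq> 0 \<Longrightarrow> hess H x *v x = 0"
  using euler_homogeneous[OF homogeneous_pd[OF homog differentiable(1)] differentiable(2)]
  by (simp add: hess_def matrix_vector_mult_def vec_eq_iff mult.commute)

lemma hess_at_unit:
  assumes x: "x \<noteq> 0"
  shows "hess H (x /\<^sub>R norm x) = norm x *\<^sub>R hess H x"
proof -
  have "pd j (pd i H) (x /\<^sub>R norm x) = norm x * pd j (pd i H) x" for i j
    using homogeneousD[OF homogeneous_pd[OF homogeneous_pd[OF homog differentiable(1)] differentiable(2)] x,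
        of "inverse (norm x)" j i] x
    by (simp add: powr_minus)
  then show ?thesis by (simp add: hess_def vec_eq_iff)
qed

end

text \<open>The support function of a smooth convex body with the origin in its interior, as a function on the whole space.
  Definiteness is required only across the radial direction, along which the function is linear.\<close>

locale smooth_gauge = smooth_homogeneous H for H :: "real^'m \<Rightarrow> real" +
  assumes zero: "H 0 = 0"
    and pos: "\<And>x. x \<noteq> 0 \<Longrightarrow> H x > 0"
    and convex: "\<And>x v. x \<noteq> 0 \<Longrightarrow> v \<noteq> 0 \<Longrightarrow> v \<bullet> x = 0 \<Longrightarrow> v \<bullet> (hess H x *v v) > 0"
begin

lemma hess_half_square_scale:
  assumes "x \<noteq> 0" "t > 0"
  shows "hess_half_square H (t *\<^sub>R x) = hess_half_square H x"
proof -
  have "pd i H (t *\<^sub>R x) = pd i H x" for i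
    using homogeneousD[OF homogeneous_pd[OF homog differentiable(1)] assms] assms by simp
  moreover have "pd j (pd i H) (t *\<^sub>R x) = pd j (pd i H) x / t" for i j
    using homogeneousD[OF homogeneous_pd[OF homogeneous_pd[OF homog differentiable(1)] differentiable(2)] assms] assms
    by (simp add: powr_minus divide_inverse mult.commute)
  moreover have "H (t *\<^sub>R x) = t * H x" using homogeneousD[OF homog assms] assms by simp
  ultimately show ?thesis using assms by (simp add: hess_half_square_def)
qed

lemma hess_half_square_mult:
  "hess_half_square H x *v v = H x *\<^sub>R (hess H x *v v) + (grad H x \<bullet> v) *\<^sub>R grad H x"
  by (simp add: hess_half_square_def hess_def grad_def matrix_vector_mult_def vec_eq_iff inner_vec_def
      algebra_simps sum.distrib sum_distrib_left)

lemma hess_half_square_sym: "x \<noteq> 0 \<Longrightarrow> transpose (hess_half_square H x) = hess_half_square H x"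
  using hess_sym[of x]
  by (auto simp: hess_half_square_def hess_def Finite_Cartesian_Product.transpose_def vec_eq_iff)

lemma hess_half_square_radial: "x \<noteq> 0 \<Longrightarrow> hess_half_square H x *v x = H x *\<^sub>R grad H x"
  by (simp add: hess_half_square_mult hess_radial grad_dot)

lemma radial_decomposition:
  assumes "x \<noteq> 0"
  obtains w s where "v = w + s *\<^sub>R x" "w \<bullet> x = 0" "v \<bullet> (hess H x *v v) = w \<bullet> (hess H x *v w)"
proof -
  define s where "s = (v \<bullet> x) / (x \<bullet> x)"
  define w where "w = v - s *\<^sub>R x"
  have "hess H x *v v = hess H x *v w"
    using hess_radial[OF assms] by (simp add: w_def matrix_vector_mult_diff_distrib matrix_vector_mult_scaleR)
  moreover have "x \<bullet> (hess H x *v w) = 0"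
    using inner_matrix_sym[OF hess_sym[OF assms], of x w] hess_radial[OF assms] by simp
  ultimately have "v \<bullet> (hess H x *v v) = w \<bullet> (hess H x *v w)" by (simp add: w_def inner_diff_left)
  then show thesis
    using that[of w s] assms by (simp add: w_def s_def inner_diff_left)
qed

lemma hess_nonneg: "x \<noteq> 0 \<Longrightarrow> v \<bullet> (hess H x *v v) \<ge> 0"
  by (metis convex inner_zero_left less_eq_real_def radial_decomposition)

lemma hess_half_square_pos:
  assumes x: "x \<noteq> 0" and v: "v \<noteq> 0"
  shows "v \<bullet> (hess_half_square H x *v v) > 0"
proof -
  have e: "v \<bullet> (hess_half_square H x *v v) = H x * (v \<bullet> (hess H x *v v)) + (grad H x \<bullet> v)\<^sup>2"
    by (simp add: hess_half_square_mult inner_add_right power2_eq_square inner_commute)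
  obtain w s where ws: "v = w + s *\<^sub>R x" "w \<bullet> x = 0" "v \<bullet> (hess H x *v v) = w \<bullet> (hess H x *v w)"
    using radial_decomposition[OF x] by blast
  show ?thesis
  proof (cases "w = 0")
    case True
    then have "s \<noteq> 0" "grad H x \<bullet> v = s * H x" using ws v grad_dot[OF x] by auto
    moreover have "v \<bullet> (hess H x *v v) = 0" using True ws(3) by simp
    ultimately show ?thesis unfolding e using pos[OF x] by simp
  next
    case False
    then have "v \<bullet> (hess H x *v v) > 0" using ws convex[OF x] by simp
    then show ?thesis unfolding e using pos[OF x] by (intro add_pos_nonneg) auto
  qed
qed

lemma det_hess_half_square_pos: "x \<noteq> 0 \<Longrightarrow> det (hess_half_square H x) > 0"
  by (intro det_pos hess_half_square_sym hess_half_square_pos)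

text \<open>The rows are the gradients of the components of the gradient of \<open>H\<^sup>2 / 2\<close>.\<close>

lemma curl_hess_half_square:
  assumes x: "x \<noteq> 0"
  shows "pd i (\<lambda>x. hess_half_square H x $ a $ b) x = pd b (\<lambda>x. hess_half_square H x $ a $ i) x"
proof -
  let ?T = "\<lambda>x. H x * pd a H x"
  have o: "open (- {0 :: real^'m})" by auto
  have "hess_half_square H y $ a $ b = pd b ?T y" if "y \<noteq> 0" for y b
    using pd_mult[OF differentiable(1,2)[OF that], of b a] by (simp add: hess_half_square_def mult.commute)
  then have "pd i (\<lambda>x. hess_half_square H x $ a $ b) x = pd i (pd b ?T) x" for i b
    using x by (intro pd_cong[OF o]) auto
  moreover have "C_k_on 2 ?T (- {0})"
    by (intro C_k_on_mult o C2 C_k_on_mono[OF C3]) auto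
  then have "pd i (pd b ?T) x = pd b (pd i ?T) x"
    using x by (intro pd_commute[OF _ o]) auto
  ultimately show ?thesis by simp
qed

lemma C_k_on_H: "k \<le> 3 \<Longrightarrow> C_k_on k H (- {0})"
  by (rule C_k_on_mono[OF C3])

lemma C_k_on_pd_H: "k \<le> 2 \<Longrightarrow> C_k_on k (pd i H) (- {0})"
  by (rule C_k_on_mono[OF C2])

lemma C_k_on_pd_pd_H: "k \<le> 1 \<Longrightarrow> C_k_on k (pd j (pd i H)) (- {0})"
  by (rule C_k_on_mono[OF C1])

lemma C_k_on_hess_half_square: "k \<le> 1 \<Longrightarrow> C_k_on k (\<lambda>x. hess_half_square H x $ a $ b) (- {0})"
  unfolding hess_half_square_def
  by (simp add: C_k_on_add C_k_on_mult C_k_on_H C_k_on_pd_H C_k_on_pd_pd_H open_Compl del: C_k_on.simps)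

text \<open>Comparison with the norm turns a cutoff by the values of \<open>H\<close> into one with annular support.\<close>

lemma gauge_bounds: "\<exists>a b. 0 < a \<and> 0 < b \<and> (\<forall>x. a * norm x \<le> H x \<and> H x \<le> b * norm x)"
proof -
  have c: "continuous_on (sphere 0 1) H"
    by (rule continuous_on_subset[OF C_k_on_imp_continuous_on[OF C3]]) auto
  have ne: "axis undefined 1 \<in> sphere (0 :: real^'m) 1" by simp
  obtain p where p: "p \<in> sphere 0 1" "\<And>y. y \<in> sphere 0 1 \<Longrightarrow> H p \<le> H y"
    using continuous_attains_inf[OF compact_sphere _ c] ne by blast
  obtain q where q: "q \<in> sphere 0 1" "\<And>y. y \<in> sphere 0 1 \<Longrightarrow> H y \<le> H q"
    using continuous_attains_sup[OF compact_sphere _ c] ne by blast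
  have "H p * norm x \<le> H x \<and> H x \<le> H q * norm x" for x
  proof (cases "x = 0")
    case False
    have "x /\<^sub>R norm x \<in> sphere 0 1" using False by simp
    moreover have "H x = norm x * H (x /\<^sub>R norm x)"
      using homogeneousD[OF homog, of "x /\<^sub>R norm x" "norm x"] False by simp
    ultimately show ?thesis using p(2) q(2) False by (simp add: mult.commute)
  qed (simp add: zero)
  moreover have "H p > 0" "H q > 0" using p q by (auto intro!: pos)
  ultimately show ?thesis by blast
qed

lemma annular_compose:
  assumes "\<And>s. s \<le> 1 \<Longrightarrow> h s = 0" "\<And>s. s \<ge> 2 \<Longrightarrow> h s = 0"
  shows "annular (\<lambda>x. h (H x))"
proof -
  obtain a b where ab: "0 < a" "0 < b" "\<And>x. a * norm x \<le> H x" "\<And>x. H x \<le> b * norm x"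
    using gauge_bounds by blast
  have "h (H x) = 0" if "norm x < 1 / b \<or> norm x > 2 / a" for x
    using that
  proof
    assume "norm x < 1 / b"
    then have "b * norm x \<le> 1" using ab by (simp add: field_simps)
    then show ?thesis using ab(4)[of x] by (intro assms(1)) simp
  next
    assume "norm x > 2 / a"
    then have "a * norm x \<ge> 2" using ab by (simp add: field_simps)
    then show ?thesis using ab(3)[of x] by (intro assms(2)) simp
  qed
  moreover have "1 / b > 0" using ab by simp
  ultimately show ?thesis unfolding annular_def by blast
qed

end

section \<open>Cutoffs by a gauge\<close>

definition bump :: "real \<Rightarrow> real" where
  "bump s = (max 0 (s - 1))\<^sup>2 * (max 0 (2 - s))\<^sup>2"

lemma bump_nonneg: "bump s \<ge> 0"
  by (simp add: bump_def)

lemma bump_pos: "1 < s \<Longrightarrow> s < 2 \<Longrightarrow> bump s > 0"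
  by (simp add: bump_def)

lemma bump_eq_0: "s \<le> 1 \<or> s \<ge> 2 \<Longrightarrow> bump s = 0"
  by (auto simp: bump_def max_def)

lemma C_k_on_square_positive_part: "C_k_on 1 (\<lambda>t::real. (max 0 t)\<^sup>2) UNIV"
proof -
  have "((\<lambda>t. (max 0 t)\<^sup>2) has_real_derivative 2 * max 0 t) (at t)" for t :: real
  proof -
    consider "t < 0" | "t > 0" | "t = 0" by linarith
    then show ?thesis
    proof cases
      case 1
      have "((\<lambda>_. 0) has_real_derivative 0) (at t)" by simp
      then have "((\<lambda>t. (max 0 t)\<^sup>2) has_real_derivative 0) (at t)"
        by (rule has_field_derivative_transform_within_open[of _ _ _ "{..<0}"]) (use 1 in auto)
      then show ?thesis using 1 by simp
    next
      case 2
      have "((\<lambda>t. t\<^sup>2) has_real_derivative 2 * t) (at t)"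
        by (auto intro!: derivative_eq_intros)
      then have "((\<lambda>t. (max 0 t)\<^sup>2) has_real_derivative 2 * t) (at t)"
        by (rule has_field_derivative_transform_within_open[of _ _ _ "{0<..}"]) (use 2 in auto)
      then show ?thesis using 2 by simp
    next
      case 3
      have "((\<lambda>h. ((max 0 h)\<^sup>2 - 0) / h) \<longlongrightarrow> 0) (at (0::real))"
      proof (rule Lim_null_comparison)
        show "eventually (\<lambda>h. norm (((max 0 h)\<^sup>2 - 0) / h) \<le> \<bar>h\<bar>) (at (0::real))"
          by (rule always_eventually) (auto simp: max_def power2_eq_square)
        show "((\<lambda>h. \<bar>h\<bar>) \<longlongrightarrow> 0) (at (0::real))" by (rule tendsto_rabs_zero) (rule tendsto_ident_at)
      qed
      then show ?thesis using 3 by (simp add: DERIV_def)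
    qed
  qed
  then have D: "((\<lambda>t. (max 0 t)\<^sup>2) has_derivative (\<lambda>v. v * (2 * max 0 t))) (at t)" for t :: real
    unfolding has_field_derivative_def by (metis (no_types, lifting) ext mult.commute)
  show ?thesis unfolding One_nat_def
    by (rule C_k_on_SucI[OF open_UNIV D]) (auto intro!: continuous_intros)
qed

lemma C_k_on_bump: "C_k_on 1 bump UNIV"
proof -
  have a: "C_k_on 1 (\<lambda>s::real. s - 1) UNIV" and b: "C_k_on 1 (\<lambda>s::real. 2 - s) UNIV"
    by (intro C_k_on_minus C_k_on_const C_k_on_linear[OF bounded_linear_ident] open_UNIV)+
  note C_k_on_compose[OF open_UNIV open_UNIV C_k_on_square_positive_part a subset_UNIV]
    C_k_on_compose[OF open_UNIV open_UNIV C_k_on_square_positive_part b subset_UNIV]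
  then show ?thesis unfolding bump_def[abs_def] by (intro C_k_on_mult open_UNIV)
qed

definition step :: "real \<Rightarrow> real" where
  "step s = integral {0..s} bump"

lemma step_deriv:
  assumes "s > 0"
  shows "(step has_real_derivative bump s) (at s)"
proof -
  have "((\<lambda>s. integral {0..s} bump) has_real_derivative bump s) (at s within {0..s + 1})"
    by (rule integral_has_real_derivative)
      (use assms C_k_on_imp_continuous_on[OF C_k_on_bump] in \<open>auto intro: continuous_on_subset\<close>)
  moreover have "at s within {0..s + 1} = at s"
    using assms by (intro at_within_interior) simp
  ultimately show ?thesis by (simp add: step_def[abs_def])
qed

lemma step_eq_0: "s \<le> 1 \<Longrightarrow> step s = 0"
  using Henstock_Kurzweil_Integration.integral_cong[of "{0..s}" bump "\<lambda>_. 0"] by (simp add: step_def bump_eq_0)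

lemma step_const: "s \<ge> 2 \<Longrightarrow> step s = step 2"
proof -
  assume s: "s \<ge> 2"
  have "bump integrable_on {0..s}"
    by (intro integrable_continuous_interval continuous_on_subset[OF C_k_on_imp_continuous_on[OF C_k_on_bump]]) auto
  then have "integral {0..2} bump + integral {2..s} bump = integral {0..s} bump"
    using s by (intro Henstock_Kurzweil_Integration.integral_combine) auto
  moreover have "integral {2..s} bump = 0"
    using Henstock_Kurzweil_Integration.integral_cong[of "{2..s}" bump "\<lambda>_. 0"] by (simp add: bump_eq_0)
  ultimately show ?thesis by (simp add: step_def)
qed

lemma C_k_on_step: "C_k_on 1 step {0<..}"
proof -
  have "(step has_derivative (\<lambda>v. v * bump s)) (at s)" if "s \<in> {0<..}" for s
    using step_deriv[of s] that unfolding has_field_derivative_def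
    by (metis (no_types, lifting) ext greaterThan_iff mult.commute)
  then show ?thesis unfolding One_nat_def
    using C_k_on_imp_continuous_on[OF C_k_on_bump]
    by (intro C_k_on_SucI) (auto intro!: continuous_intros intro: continuous_on_subset)
qed

lemma open_punctured: "open (- {0 :: 'a::real_normed_vector})"
  by auto

context smooth_gauge
begin

lemma continuous_on_bump_weight:
  assumes "continuous_on (- {0}) g"
  shows "continuous_on (- {0}) (\<lambda>x. g x * (H x * bump (H x)))"
  using assms C_k_on_imp_continuous_on[OF C3]
    continuous_on_compose2[OF C_k_on_imp_continuous_on[OF C_k_on_bump], of "- {0}" H]
  by (intro continuous_intros) auto

lemma annular_bump_weight: "annular (\<lambda>x. g x * (H x * bump (H x)))"
proof -
  have "annular (\<lambda>x. bump (H x))" by (rule annular_compose) (auto simp: bump_eq_0)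
  then show ?thesis by (rule annular_weaken) simp
qed

end

text \<open>In polar coordinates the radial integrals on both sides equal \<open>\<integral> bump\<close>, independently of the gauge.
  Equivalently, the difference of the integrands is the divergence of \<open>x g(x) (step (H x) - step (K x))\<close>: the field
  \<open>x g(x)\<close> is divergence free because \<open>g\<close> has minus the dimension as its degree, and the two steps agree near
  the origin and near infinity.\<close>

lemma integral_gauge_independent:
  fixes H K g :: "real^'m \<Rightarrow> real"
  assumes "smooth_gauge H" "smooth_gauge K"
    and g: "C_k_on 1 g (- {0})" "homogeneous (- real CARD('m)) g"
  shows "(\<integral>x. g x * (H x * bump (H x)) \<partial>lborel) = (\<integral>x. g x * (K x * bump (K x)) \<partial>lborel)"
proof -
  interpret H: smooth_gauge H by fact
  interpret K: smooth_gauge K by fact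
  let ?d = "\<lambda>x. step (H x) - step (K x)"
  let ?V = "\<lambda>i x. x $ i * (g x * ?d x)"
  have dg: "g differentiable (at x)" if "x \<noteq> 0" for x using g(1) that by auto
  have ds: "C_k_on 1 (\<lambda>x. step (H x)) (- {0})" "C_k_on 1 (\<lambda>x. step (K x)) (- {0})"
    by (rule C_k_on_compose[OF open_punctured open_greaterThan C_k_on_step];
      use H.C_k_on_H[of 1] K.C_k_on_H[of 1] H.pos K.pos in \<open>auto simp del: C_k_on.simps One_nat_def\<close>)+
  have cd: "C_k_on 1 ?d (- {0})"
    by (intro C_k_on_minus ds open_punctured)
  have ann: "annular ?d"
  proof -
    obtain a b where ab: "0 < a" "0 < b" "\<And>x. a * norm x \<le> H x" "\<And>x. H x \<le> b * norm x"
      using H.gauge_bounds by blast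
    obtain a' b' where ab': "0 < a'" "0 < b'" "\<And>x. a' * norm x \<le> K x" "\<And>x. K x \<le> b' * norm x"
      using K.gauge_bounds by blast
    have "step (H x) - step (K x) = 0" if "norm x < min (1 / b) (1 / b') \<or> norm x > max (2 / a) (2 / a')" for x
      using that
    proof
      assume "norm x < min (1 / b) (1 / b')"
      then have "b * norm x \<le> 1" "b' * norm x \<le> 1" using ab ab' by (auto simp: field_simps)
      then show ?thesis using ab(4)[of x] ab'(4)[of x] by (simp add: step_eq_0)
    next
      assume "norm x > max (2 / a) (2 / a')"
      then have "a * norm x \<ge> 2" "a' * norm x \<ge> 2" using ab ab' by (auto simp: field_simps)
      then show ?thesis using ab(3)[of x] ab'(3)[of x] step_const[of "H x"] step_const[of "K x"] by simp
    qed
    moreover have "min (1 / b) (1 / b') > 0" using ab ab' by simp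
    ultimately show ?thesis unfolding annular_def by blast
  qed
  \<comment> \<open>By Euler's relation the terms without a derivative of the steps cancel.\<close>
  have div: "(\<Sum>i\<in>UNIV. pd i (?V i) x) = g x * (H x * bump (H x)) - g x * (K x * bump (K x))" for x
  proof (cases "x = 0")
    case False
    have d: "g differentiable (at x)" "?d differentiable (at x)" "(\<lambda>x. step (H x)) differentiable (at x)"
      "(\<lambda>x. step (K x)) differentiable (at x)"
      using dg[OF False] cd ds False by auto
    have gd: "(\<lambda>x. g x * ?d x) differentiable (at x)" using d(1,2) by (rule differentiable_mult)
    have ci: "(\<lambda>x. x $ i) differentiable (at x)" for i
      by (intro bounded_linear_imp_differentiable bounded_linear_vec_nth)
    have D: "pd i ?d x = bump (H x) * pd i H x - bump (K x) * pd i K x" for i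
      using pd_minus[OF d(3,4)] pd_compose[OF step_deriv[OF H.pos[OF False]] H.differentiable(1)[OF False]]
        pd_compose[OF step_deriv[OF K.pos[OF False]] K.differentiable(1)[OF False]] by simp
    then have "pd i (?V i) x = g x * ?d x + x $ i * pd i g x * ?d x +
        g x * (bump (H x) * (x $ i * pd i H x) - bump (K x) * (x $ i * pd i K x))" for i
      by (simp only: pd_mult[OF ci gd] pd_mult[OF d(1,2)] D pd_component if_True) (simp add: algebra_simps)
    then have "(\<Sum>i\<in>UNIV. pd i (?V i) x) = real CARD('m) * (g x * ?d x) + (\<Sum>i\<in>UNIV. x $ i * pd i g x) * ?d x +
        g x * (bump (H x) * (\<Sum>i\<in>UNIV. x $ i * pd i H x) - bump (K x) * (\<Sum>i\<in>UNIV. x $ i * pd i K x))"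
      by (simp add: sum.distrib sum_distrib_left sum_distrib_right sum_subtractf right_diff_distrib)
    then show ?thesis
      using euler_homogeneous[OF g(2) dg[OF False] False]
        euler_homogeneous[OF H.homog H.differentiable(1)[OF False] False]
        euler_homogeneous[OF K.homog K.differentiable(1)[OF False] False]
      by (simp add: algebra_simps)
  next
    case True
    obtain a where a: "a > 0" "\<And>y. norm y < a \<Longrightarrow> ?d y = 0"
      using ann unfolding annular_def by blast
    have "pd i (?V i) x = pd i (\<lambda>_. 0) x" for i
      using a True by (intro pd_cong[of "ball 0 a"]) auto
    then show ?thesis using True by (simp add: pd_eqI[OF has_derivative_const] H.zero K.zero)
  qed
  have ib: "integrable lborel (\<lambda>x. g x * (L x * bump (L x)))" if "smooth_gauge L" for L
    using that C_k_on_imp_continuous_on[OF g(1)]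
    by (intro integrable_annular smooth_gauge.annular_bump_weight smooth_gauge.continuous_on_bump_weight)
  have "(\<integral>x. (\<Sum>i\<in>UNIV. pd i (?V i) x) \<partial>lborel) = 0"
  proof (rule integral_divergence_annular)
    fix i
    show "C_k_on 1 (?V i) (- {0})"
      by (intro C_k_on_mult open_punctured cd g(1) C_k_on_linear bounded_linear_vec_nth)
    show "annular (?V i)" using ann by (rule annular_weaken) simp
  qed
  then show ?thesis
    unfolding div using ib assms(1,2) by (simp add: Bochner_Integration.integral_diff)
qed

section \<open>The linearized determinant of a gauge\<close>

lemma det_rr_scaled: "det (replace_row B k (a *\<^sub>R u)) = a * det (replace_row B k u)"
  using linear_cmul[OF linear_det_replace_row] by simp

lemma det_rr_add: "det (replace_row B k (u + v)) = det (replace_row B k u) + det (replace_row B k v)"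
  using linear_add[OF linear_det_replace_row] .

lemma det_rr_minus: "det (replace_row B k (u - v)) = det (replace_row B k u) - det (replace_row B k v)"
  using linear_diff[OF linear_det_replace_row] .

lemma replace_row_self: "replace_row B k (B $ k) = B"
  by (simp add: replace_row_def vec_eq_iff)

context smooth_gauge
begin

text \<open>The gradient is the combination of the rows with coefficients \<open>x / H x\<close>, since the symmetric matrix
  \<open>hess_half_square H x\<close> maps \<open>x\<close> to \<open>H x\<close> times the gradient.\<close>

lemma det_replace_row_grad:
  assumes x: "x \<noteq> 0"
  shows "det (replace_row (hess_half_square H x) k (grad H x)) = x $ k / H x * det (hess_half_square H x)"
proof -
  let ?B = "hess_half_square H x"
  have "((1 / H x) *\<^sub>R x) v* ?B = grad H x"
    using pos[OF x] hess_half_square_radial[OF x] hess_half_square_sym[OF x]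
    by (metis (no_types, lifting) divide_self_if less_irrefl matrix_vector_mult_scaleR scaleR_one
        scaleR_scaleR times_divide_eq_left mult_1 vector_transpose_matrix)
  then show ?thesis using det_replace_row_combination[of ?B k "(1 / H x) *\<^sub>R x"] by simp
qed

text \<open>With \<open>B = hess_half_square H x\<close>, the left side is \<open>det B\<close> times the product of \<open>u\<close> with \<open>B\<^sup>-\<^sup>1 (grad H x)\<close>, and
  this vector is \<open>x / H x\<close>.\<close>

lemma sum_grad_det_replace_row:
  assumes x: "x \<noteq> 0"
  shows "(\<Sum>k\<in>UNIV. pd k H x * det (replace_row (hess_half_square H x) k u)) =
    (u \<bullet> x) / H x * det (hess_half_square H x)"
proof -
  let ?B = "hess_half_square H x"
  have "invertible ?B" using det_hess_half_square_pos[OF x] by (simp add: invertible_det_nz)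
  then obtain C where C: "C ** ?B = mat 1" unfolding invertible_def by blast
  define c where "c = u v* C"
  have c: "c v* ?B = u" using C by (simp add: c_def vector_matrix_mul_assoc)
  have "(\<Sum>k\<in>UNIV. pd k H x * det (replace_row ?B k u)) = (c \<bullet> grad H x) * det ?B"
    using det_replace_row_combination[of ?B _ c] by (simp add: c inner_vec_def grad_def sum_distrib_left mult.commute mult.left_commute)
  also have "c \<bullet> grad H x = (c \<bullet> (?B *v x)) / H x"
    using pos[OF x] hess_half_square_radial[OF x] by simp
  also have "c \<bullet> (?B *v x) = u \<bullet> x" by (simp add: dot_lmul_matrix[symmetric] c)
  finally show ?thesis .
qed

lemma det_variation_rank_one:
  assumes x: "x \<noteq> 0"
  shows "det_variation (hess_half_square H x) (\<chi> i j. M $ i $ j + l * (grad H x $ i * grad H x $ j)) =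
    det_variation (hess_half_square H x) M + l * det (hess_half_square H x)"
proof -
  let ?B = "hess_half_square H x"
  have r: "(\<chi> i j. M $ i $ j + l * (grad H x $ i * grad H x $ j)) $ k = M $ k + (l * pd k H x) *\<^sub>R grad H x" for k
    by (simp add: vec_eq_iff grad_def)
  have "(\<Sum>k\<in>UNIV. pd k H x * det (replace_row ?B k (grad H x))) = det ?B"
    using sum_grad_det_replace_row[OF x, of "grad H x"] grad_dot[OF x] pos[OF x] by simp
  then show ?thesis
    by (simp only: det_variation_def r det_rr_add det_rr_scaled sum.distrib mult.assoc sum_distrib_left[symmetric])
qed

lemma det_variation_scale: "det_variation B (\<chi> i j. a * M $ i $ j) = a * det_variation B M"
proof -
  have "(\<chi> i j. a * M $ i $ j) $ k = a *\<^sub>R M $ k" for k by (simp add: vec_eq_iff)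
  then show ?thesis by (simp add: det_variation_def det_rr_scaled sum_distrib_left)
qed

lemma det_variation_hess:
  assumes x: "x \<noteq> 0"
  shows "det_variation (hess_half_square H x) (hess H x) = (real CARD('m) - 1) / H x * det (hess_half_square H x)"
proof -
  let ?B = "hess_half_square H x"
  have "?B = (\<chi> i j. (\<chi> i j. H x * hess H x $ i $ j) $ i $ j + 1 * (grad H x $ i * grad H x $ j))"
    by (simp add: hess_half_square_def hess_def grad_def vec_eq_iff)
  then have "det_variation ?B ?B = H x * det_variation ?B (hess H x) + det ?B"
    using det_variation_rank_one[OF x, of "\<chi> i j. H x * hess H x $ i $ j" 1] det_variation_scale[of ?B "H x" "hess H x"]
    by simp
  moreover have "det_variation ?B ?B = real CARD('m) * det ?B"
    by (simp add: det_variation_def replace_row_self)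
  ultimately show ?thesis using pos[OF x] by (simp add: field_simps)
qed

text \<open>At unit vectors, the reciprocal of the Gauss curvature of the boundary of the convex body with support
  function \<open>H\<close>, as a function of the normal.\<close>

definition curvature :: "real^'m \<Rightarrow> real" where
  "curvature x = frame_det (x /\<^sub>R norm x) (\<lambda>v w. v \<bullet> (hess H x *v w))"

lemma grad_dot_unit: "x \<noteq> 0 \<Longrightarrow> grad H x \<bullet> (x /\<^sub>R norm x) = H x / norm x"
  by (simp add: grad_dot divide_inverse mult.commute)

lemma hess_unit: "x \<noteq> 0 \<Longrightarrow> hess H x *v (x /\<^sub>R norm x) = 0"
  by (simp add: matrix_vector_mult_scaleR hess_radial)

end

lemma frame_det_scale:
  fixes x :: "'a::euclidean_space"
  shows "frame_det x (\<lambda>v w. a * A v w) = a ^ (DIM('a) - 1) * frame_det x A"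
proof -
  have "frame_matrix e (\<lambda>v w. a * A v w) = a \<cdot>\<^sub>m frame_matrix e A" for e
    by (rule eq_matI) (auto simp: frame_matrix_def)
  then show ?thesis by (simp add: frame_det_def frame_matrix_def)
qed

context smooth_gauge
begin

lemma det_hess_half_square:
  assumes x: "x \<noteq> 0"
  shows "det (hess_half_square H x) = (H x / norm x)\<^sup>2 * H x ^ (CARD('m) - 1) * curvature x"
proof -
  let ?M = "\<chi> i j. H x * hess H x $ i $ j"
  let ?e = "x /\<^sub>R norm x"
  have Mv: "?M *v v = H x *\<^sub>R (hess H x *v v)" for v
    by (simp add: matrix_vector_mult_def vec_eq_iff sum_distrib_left mult.assoc)
  have "hess_half_square H x = (\<chi> i j. ?M $ i $ j + 1 * (grad H x $ i * grad H x $ j))"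
    by (simp add: hess_half_square_def hess_def grad_def vec_eq_iff)
  also have "det \<dots> = 1 * (grad H x \<bullet> ?e)\<^sup>2 * frame_det ?e (\<lambda>v w. v \<bullet> (?M *v w))"
  proof (rule det_rank_one_perturbation)
    show "transpose ?M = ?M"
      using hess_sym[OF x] by (auto simp: Finite_Cartesian_Product.transpose_def vec_eq_iff)
    show "?M *v ?e = 0" using hess_unit[OF x] by (simp add: Mv)
    show "norm ?e = 1" using x by simp
    show "grad H x \<bullet> ?e \<noteq> 0" using grad_dot_unit[OF x] pos[OF x] x by simp
  qed
  also have "(\<lambda>v w. v \<bullet> (?M *v w)) = (\<lambda>v w. H x * (v \<bullet> (hess H x *v w)))" by (simp add: Mv)
  finally show ?thesis
    using grad_dot_unit[OF x] by (simp add: frame_det_scale curvature_def)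
qed

lemma curvature_pos:
  assumes x: "x \<noteq> 0"
  shows "curvature x > 0"
proof -
  have "(H x / norm x)\<^sup>2 * H x ^ (CARD('m) - 1) > 0" using pos[OF x] x by simp
  with det_hess_half_square_pos[OF x] show ?thesis
    unfolding det_hess_half_square[OF x] by (rule zero_less_mult_pos)
qed

lemma C_k_on_det_hess_half_square: "k \<le> 1 \<Longrightarrow> C_k_on k (\<lambda>x. det (hess_half_square H x)) (- {0})"
  by (intro C_k_on_det open_punctured C_k_on_hess_half_square)

end

locale gauge_pair = H: smooth_gauge H + K: smooth_gauge K for H K :: "real^'m \<Rightarrow> real"
begin

text \<open>The inequality \<open>tr (A\<^sub>K\<^sup>-\<^sup>1 A\<^sub>H) \<ge> n (det A\<^sub>H / det A\<^sub>K)\<^bsup>1/n\<^esup>\<close> for the tangential Hessians of \<open>H\<close> and \<open>K\<close>,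
  obtained from its analogue in one dimension more.\<close>

lemma det_variation_hess_ge:
  assumes x: "x \<noteq> 0" and n: "CARD('m) = n + 1" "n \<ge> 1"
  shows "det_variation (hess_half_square K x) (hess H x) \<ge>
    n / K x * (H.curvature x / K.curvature x) powr (1 / n) * det (hess_half_square K x)"
proof -
  let ?B = "hess_half_square K x" and ?e = "x /\<^sub>R norm x"
  define R where "R = H.curvature x / K.curvature x"
  have R: "R > 0" using H.curvature_pos[OF x] K.curvature_pos[OF x] by (simp add: R_def)
  have Kp: "K x > 0" by (rule K.pos[OF x])
  \<comment> \<open>The rank one term lifts the tangential form to a definite form on the whole space; its weight
    makes the inequality between the means sharp when the two tangential forms are proportional.\<close>
  define l where "l = R powr (1 / n) / K x"
  have l: "l > 0" using R Kp by (simp add: l_def)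
  let ?M = "\<chi> i j. hess H x $ i $ j + l * (grad K x $ i * grad K x $ j)"
  have Mv: "?M *v v = hess H x *v v + (l * (grad K x \<bullet> v)) *\<^sub>R grad K x" for v
    by (simp add: matrix_vector_mult_def vec_eq_iff inner_vec_def algebra_simps sum.distrib sum_distrib_left)
  have "det_variation ?B ?M \<ge> CARD('m) * (det ?M / det ?B) powr (1 / CARD('m)) * det ?B"
  proof (rule det_variation_ge)
    show "transpose ?M = ?M"
      using H.hess_sym[OF x] by (auto simp: Finite_Cartesian_Product.transpose_def vec_eq_iff)
    show "v \<bullet> (?M *v v) \<ge> 0" for v
      unfolding Mv using H.hess_nonneg[OF x, of v] l by (simp add: inner_add_right inner_commute mult.assoc)
  qed (use x in \<open>auto intro: K.hess_half_square_sym K.hess_half_square_pos\<close>)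
  moreover have "(det ?M / det ?B) powr (1 / CARD('m)) = R powr (1 / n) / K x"
  proof -
    have "det ?M = l * (grad K x \<bullet> ?e)\<^sup>2 * H.curvature x"
      unfolding H.curvature_def
      by (rule det_rank_one_perturbation)
        (use H.hess_sym[OF x] H.hess_unit[OF x] K.grad_dot_unit[OF x] Kp x in auto)
    then have "det ?M / det ?B = l * R / K x ^ n"
      using K.det_hess_half_square[OF x] K.grad_dot_unit[OF x] Kp x n by (simp add: R_def)
    also have "\<dots> = R powr (1 + 1 / n) / K x powr (n + 1)"
      using R Kp n by (simp add: l_def powr_add powr_realpow)
    also have "\<dots> powr (1 / CARD('m)) = R powr (1 / n) / K x"
    proof -
      have "(1 + 1 / real n) / (1 + real n) = 1 / n" using n by (simp add: divide_simps)
      then show ?thesis using R Kp n by (simp add: powr_divide powr_powr)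
    qed
    finally show ?thesis .
  qed
  ultimately have "det_variation ?B (hess H x) + l * det ?B \<ge> (n + 1) * (R powr (1 / n) / K x) * det ?B"
    using n by (simp add: K.det_variation_rank_one[OF x])
  moreover have "(n + 1) * (R powr (1 / n) / K x) * det ?B = n / K x * R powr (1 / n) * det ?B + l * det ?B"
    unfolding l_def of_nat_add of_nat_1 ring_distribs by simp
  ultimately show ?thesis unfolding R_def[symmetric] by linarith
qed

lemma C_k_on_ratio: "k \<le> 3 \<Longrightarrow> C_k_on k (\<lambda>x. H x / K x) (- {0})"
proof -
  assume k: "k \<le> 3"
  have "C_k_on k (\<lambda>x. H x * K x powr -1) (- {0})"
    by (intro C_k_on_mult C_k_on_powr_compose open_punctured H.C_k_on_H K.C_k_on_H k K.pos) auto
  also have "?this = C_k_on k (\<lambda>x. H x / K x) (- {0})"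
    by (intro C_k_on_cong open_punctured) (simp add: powr_minus divide_inverse abs_of_pos K.pos)
  finally show ?thesis .
qed

text \<open>Self-adjointness of the linearized determinant at \<open>K\<close>, tested with \<open>H\<close> and \<open>K\<close>: the integrand is the
  divergence of the cofactor matrix of \<open>hess_half_square K\<close> applied to \<open>\<psi>(K) (K grad H - H grad K)\<close>. In
  this divergence a factor \<open>grad K\<close> that meets the cofactor matrix acts as a multiple of \<open>x\<close>. Hence the term with the
  derivative of \<open>\<psi>\<close> contains \<open>K (x \<bullet> grad H) - H (x \<bullet> grad K)\<close>, which vanishes as \<open>H\<close> and \<open>K\<close> have the same
  degree, and the other two terms of first order cancel.\<close>

lemma integral_gauge_identity:
  fixes \<psi> :: "real \<Rightarrow> real"
  assumes \<psi>: "C_k_on 1 \<psi> {0<..}" "\<And>s. s \<le> 1 \<Longrightarrow> \<psi> s = 0" "\<And>s. s \<ge> 2 \<Longrightarrow> \<psi> s = 0"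
  shows "integrable lborel (\<lambda>x. \<psi> (K x) * (K x * det_variation (hess_half_square K x) (hess H x) -
      (real CARD('m) - 1) * (H x / K x) * det (hess_half_square K x)))"
    and "(\<integral>x. \<psi> (K x) * (K x * det_variation (hess_half_square K x) (hess H x) -
      (real CARD('m) - 1) * (H x / K x) * det (hess_half_square K x)) \<partial>lborel) = 0"
proof -
  let ?B = "hess_half_square K"
  let ?F = "\<lambda>x. \<psi> (K x) * (K x * det_variation (?B x) (hess H x) -
      (real CARD('m) - 1) * (H x / K x) * det (?B x))"
  define \<zeta> where "\<zeta> k x = \<psi> (K x) * (K x * pd k H x - H x * pd k K x)" for k x
  have cpsi: "C_k_on 1 (\<lambda>x. \<psi> (K x)) (- {0})"
    by (rule C_k_on_compose[OF open_punctured open_greaterThan \<psi>(1)])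
      (use K.C_k_on_H[of 1] K.pos in \<open>auto simp del: C_k_on.simps One_nat_def\<close>)
  have cz: "C_k_on 1 (\<zeta> k) (- {0})" for k
    unfolding \<zeta>_def[abs_def]
    by (intro C_k_on_mult C_k_on_minus cpsi open_punctured H.C_k_on_H K.C_k_on_H H.C_k_on_pd_H K.C_k_on_pd_H) auto
  have annp: "annular (\<lambda>x. \<psi> (K x))" using \<psi>(2,3) by (rule K.annular_compose)
  have annz: "annular (\<zeta> k)" for k
    using annp by (rule annular_weaken) (simp add: \<zeta>_def)
  have zero: "(\<integral>x. det (replace_row (?B x) k (\<chi> i. pd i (\<zeta> k) x)) \<partial>lborel) = 0" for k
    by (rule integral_det_replace_row_gradient)
      (use cz annz K.C_k_on_hess_half_square K.curl_hess_half_square in \<open>auto simp del: C_k_on.simps\<close>)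
  have sum: "(\<Sum>k\<in>UNIV. det (replace_row (?B x) k (\<chi> i. pd i (\<zeta> k) x))) = ?F x" if x: "x \<noteq> 0" for x
  proof -
    let ?D = "frechet_derivative \<psi> (at (K x)) 1"
    have "\<psi> differentiable (at (K x))" using \<psi>(1) K.pos[OF x] by auto
    then have "(\<psi> has_derivative frechet_derivative \<psi> (at (K x))) (at (K x))"
      using frechet_derivative_works by blast
    then have "(\<psi> has_real_derivative ?D) (at (K x))"
      unfolding has_field_derivative_def
      by (metis (no_types, lifting) ext has_derivative_linear linear_cmul mult.commute mult_1 real_scaleR_def)
    note dpsi = pd_compose[OF this K.differentiable(1)[OF x]]
    let ?c = "\<lambda>k. K x * pd k H x - H x * pd k K x"
    have row: "(\<chi> i. pd i (\<zeta> k) x) = (?D * ?c k) *\<^sub>R grad K x + \<psi> (K x) *\<^sub>R (pd k H x *\<^sub>R grad K x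
        + K x *\<^sub>R hess H x $ k - pd k K x *\<^sub>R grad H x - H x *\<^sub>R hess K x $ k)" for k
    proof -
      have d: "(\<lambda>x. \<psi> (K x)) differentiable (at x)" using cpsi x by auto
      note dH = H.differentiable[OF x] and dK = K.differentiable[OF x]
      have "pd i (\<zeta> k) x = \<psi> (K x) * ((K x * pd i (pd k H) x + pd i K x * pd k H x)
          - (H x * pd i (pd k K) x + pd i H x * pd k K x)) + ?D * pd i K x * ?c k" for i
        unfolding \<zeta>_def[abs_def]
        using pd_mult[OF d differentiable_diff[OF differentiable_mult[OF dK(1) dH(2)] differentiable_mult[OF dH(1) dK(2)]], of i k k]
          pd_minus[OF differentiable_mult[OF dK(1) dH(2)] differentiable_mult[OF dH(1) dK(2)], of i k k]
          pd_mult[OF dK(1) dH(2), of i k] pd_mult[OF dH(1) dK(2), of i k] dpsi[of i] by simp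
      then show ?thesis by (simp add: vec_eq_iff grad_def hess_def algebra_simps)
    qed
    define d where "d = det (?B x) / K x"
    have rd: "det (replace_row (?B x) k (grad K x)) = x $ k * d" for k
      by (simp add: d_def K.det_replace_row_grad[OF x])
    have "(\<Sum>k\<in>UNIV. ?D * ?c k * det (replace_row (?B x) k (grad K x))) = 0"
    proof -
      have "(\<Sum>k\<in>UNIV. ?D * ?c k * det (replace_row (?B x) k (grad K x))) =
        ?D * d * (K x * (\<Sum>k\<in>UNIV. x $ k * pd k H x) - H x * (\<Sum>k\<in>UNIV. x $ k * pd k K x))"
        unfolding rd by (simp add: sum_distrib_left sum_subtractf algebra_simps)
      then show ?thesis
        using euler_homogeneous[OF H.homog H.differentiable(1)[OF x] x]
          euler_homogeneous[OF K.homog K.differentiable(1)[OF x] x] by simp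
    qed
    moreover have "(\<Sum>k\<in>UNIV. pd k H x * det (replace_row (?B x) k (grad K x))) = H x / K x * det (?B x)"
    proof -
      have "(\<Sum>k\<in>UNIV. pd k H x * det (replace_row (?B x) k (grad K x))) =
        (\<Sum>k\<in>UNIV. x $ k * pd k H x) * d"
        unfolding rd by (simp add: sum_distrib_left mult.commute mult.left_commute)
      then show ?thesis unfolding d_def using euler_homogeneous[OF H.homog H.differentiable(1)[OF x] x] by simp
    qed
    moreover have "(\<Sum>k\<in>UNIV. pd k K x * det (replace_row (?B x) k (grad H x))) = H x / K x * det (?B x)"
      using K.sum_grad_det_replace_row[OF x, of "grad H x"] H.grad_dot[OF x] by simp
    moreover have "(\<Sum>k\<in>UNIV. det (replace_row (?B x) k (hess K x $ k))) = (real CARD('m) - 1) / K x * det (?B x)"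
      using K.det_variation_hess[OF x] by (simp add: det_variation_def)
    moreover have "(\<Sum>k\<in>UNIV. det (replace_row (?B x) k (\<chi> i. pd i (\<zeta> k) x))) =
      (\<Sum>k\<in>UNIV. ?D * ?c k * det (replace_row (?B x) k (grad K x))) +
      \<psi> (K x) * ((\<Sum>k\<in>UNIV. pd k H x * det (replace_row (?B x) k (grad K x)))
        + K x * det_variation (?B x) (hess H x)
        - (\<Sum>k\<in>UNIV. pd k K x * det (replace_row (?B x) k (grad H x)))
        - H x * (\<Sum>k\<in>UNIV. det (replace_row (?B x) k (hess K x $ k))))"
      unfolding row det_rr_add det_rr_scaled det_rr_minus det_variation_def
      by (simp only: sum.distrib sum_subtractf sum_distrib_left[symmetric])
    ultimately show ?thesis by simp
  qed
  have sum0: "(\<Sum>k\<in>UNIV. det (replace_row (?B x) k (\<chi> i. pd i (\<zeta> k) x))) = ?F x" for x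
  proof (cases "x = 0")
    case True
    have "pd i (\<zeta> k) x = 0" for i k
    proof -
      obtain a where a: "a > 0" "\<And>y. norm y < a \<Longrightarrow> \<zeta> k y = 0"
        using annz[of k] unfolding annular_def by blast
      have "pd i (\<zeta> k) x = pd i (\<lambda>_. 0) x"
        using a True by (intro pd_cong[of "ball 0 a"]) auto
      then show ?thesis by (simp add: pd_eqI[OF has_derivative_const])
    qed
    moreover have "(\<chi> i. 0) = (0 :: real^'m)" by (simp add: vec_eq_iff)
    ultimately show ?thesis
      using True K.zero \<psi>(2)[of 0] linear_0[OF linear_det_replace_row[of "?B x"]] by simp
  qed (rule sum)
  have int: "integrable lborel (\<lambda>x. det (replace_row (?B x) k (\<chi> i. pd i (\<zeta> k) x)))" for k
  proof (rule integrable_annular)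
    have "C_k_on 0 (\<lambda>x. replace_row (?B x) k (\<chi> i. pd i (\<zeta> k) x) $ a $ b) (- {0})" for a b
      using K.C_k_on_hess_half_square[of 0 a b] C_k_on_pd[of 0 "\<zeta> k" "- {0}" b] cz[of k]
      by (cases "a = k") (simp_all add: replace_row_def)
    then have "C_k_on 0 (\<lambda>x. det (replace_row (?B x) k (\<chi> i. pd i (\<zeta> k) x))) (- {0})"
      by (rule C_k_on_det[OF open_punctured])
    then show "continuous_on (- {0}) (\<lambda>x. det (replace_row (?B x) k (\<chi> i. pd i (\<zeta> k) x)))" by simp
    obtain a R where a: "a > 0" "\<And>y. norm y < a \<Longrightarrow> \<zeta> k y = 0" "\<And>y. norm y > R \<Longrightarrow> \<zeta> k y = 0"
      using annz[of k] unfolding annular_def by blast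
    have "det (replace_row (?B y) k (\<chi> i. pd i (\<zeta> k) y)) = 0" if "norm y < a \<or> norm y > R" for y
    proof -
      have "open {y :: real^'m. norm y < a}" "open {y :: real^'m. norm y > R}"
        by (intro open_Collect_less continuous_intros)+
      then have "pd i (\<zeta> k) y = pd i (\<lambda>_. 0) y" for i
        using that a pd_cong[of "{y. norm y < a}" y "\<zeta> k" "\<lambda>_. 0" i] pd_cong[of "{y. norm y > R}" y "\<zeta> k" "\<lambda>_. 0" i]
        by auto
      then have "pd i (\<zeta> k) y = 0" for i by (simp add: pd_eqI[OF has_derivative_const])
      moreover have "(\<chi> i. 0) = (0 :: real^'m)" by (simp add: vec_eq_iff)
      ultimately show ?thesis using linear_0[OF linear_det_replace_row[of "?B y" k]] by simp
    qed
    then show "annular (\<lambda>x. det (replace_row (?B x) k (\<chi> i. pd i (\<zeta> k) x)))"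
      unfolding annular_def using a(1) by blast
  qed
  show "integrable lborel ?F"
    using Bochner_Integration.integrable_sum[of UNIV lborel "\<lambda>k x. det (replace_row (?B x) k (\<chi> i. pd i (\<zeta> k) x))"] int
    by (simp add: sum0)
  show "(\<integral>x. ?F x \<partial>lborel) = 0"
    using Bochner_Integration.integral_sum[of UNIV lborel "\<lambda>k x. det (replace_row (?B x) k (\<chi> i. pd i (\<zeta> k) x))"] int zero
    by (simp add: sum0)
qed

end

section \<open>Uniqueness among gauges\<close>

lemma continuous_nonneg_integral_nonpos_imp_zero:
  fixes f :: "'a::euclidean_space \<Rightarrow> real"
  assumes c: "continuous_on UNIV f" and nn: "\<And>x. f x \<ge> 0"
    and int: "integrable lborel f" and le: "(\<integral>x. f x \<partial>lborel) \<le> 0"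
  shows "f x = 0"
proof (rule ccontr)
  assume "f x \<noteq> 0"
  have "(\<integral>x. f x \<partial>lborel) = 0" using le nn by (intro antisym integral_nonneg_AE) auto
  then have "AE x in lborel. f x = 0"
    using integral_nonneg_eq_0_iff_AE[OF int] nn by simp
  moreover have o: "open {x. f x \<noteq> 0}"
    using c by (intro open_Collect_neq) (auto intro: continuous_intros)
  ultimately have "{x. f x \<noteq> 0} \<in> null_sets lborel"
    using AE_iff_null_sets[of "{x. f x \<noteq> 0}" lborel] by auto
  then have "negligible {x. f x \<noteq> 0}"
    unfolding negligible_iff_null_sets by (rule null_sets_completionI)
  then show False using open_not_negligible[OF o] \<open>f x \<noteq> 0\<close> by blast
qed

context gauge_pair
begin

text \<open>For \<open>|x| = 1\<close> and the restrictions \<open>u\<^sub>1\<close> and \<open>u\<^sub>2\<close> of \<open>H\<close> and \<open>K\<close> this is the integrand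
  \<open>u\<^sub>2 det A\<^sub>2 (r - r\<^sup>p)\<close> over the sphere; the power of \<open>K\<close> makes it homogeneous of the degree to which
  \<open>integral_gauge_independent\<close> applies.\<close>

definition weight :: "real \<Rightarrow> real^'m \<Rightarrow> real" where
  "weight p x = K x powr (- real CARD('m)) * det (hess_half_square K x) * (H x / K x - (H x / K x) powr p)"

lemma C_k_on_weight: "k \<le> 1 \<Longrightarrow> C_k_on k (weight p) (- {0})"
  unfolding weight_def[abs_def]
  by (intro C_k_on_mult C_k_on_minus C_k_on_powr_compose open_punctured C_k_on_ratio K.C_k_on_H
      K.C_k_on_det_hess_half_square) (auto intro: K.pos H.pos divide_pos_pos)

lemma ratio_scale: "x \<noteq> 0 \<Longrightarrow> t > 0 \<Longrightarrow> H (t *\<^sub>R x) / K (t *\<^sub>R x) = H x / K x"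
  using homogeneousD[OF H.homog] homogeneousD[OF K.homog] by simp

lemma homogeneous_weight: "homogeneous (- real CARD('m)) (weight p)"
  unfolding homogeneous_def
proof (intro allI impI)
  fix x :: "real^'m" and t :: real assume xt: "x \<noteq> 0" "t > 0"
  have "K (t *\<^sub>R x) powr (- real CARD('m)) = t powr (- real CARD('m)) * K x powr (- real CARD('m))"
    using homogeneousD[OF K.homog xt] xt K.pos[OF xt(1)] by (simp add: powr_mult)
  then show "weight p (t *\<^sub>R x) = t powr (- real CARD('m)) * weight p x"
    unfolding weight_def ratio_scale[OF xt] K.hess_half_square_scale[OF xt] by simp
qed

text \<open>The identity \<open>integral_gauge_identity\<close>, whose trace term is bounded from below by
  \<open>det_variation_hess_ge\<close>.\<close>

lemma weight_integral_nonneg: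
  assumes n: "CARD('m) = n + 1" "n \<ge> 1"
    and rel: "\<And>x. x \<noteq> 0 \<Longrightarrow> H.curvature x / K.curvature x = (H x / K x) powr q"
  shows "(\<integral>x. weight (q / n) x * (K x * bump (K x)) \<partial>lborel) \<ge> 0"
proof -
  \<comment> \<open>With this power of \<open>s\<close>, \<open>\<psi> (K x)\<close> is the product of the power of \<open>K\<close> in \<open>weight\<close> with
    \<open>K x * bump (K x)\<close>.\<close>
  define \<psi> where "\<psi> s = s powr (- real n) * bump s" for s
  have psi: "C_k_on 1 \<psi> {0<..}"
    unfolding \<psi>_def[abs_def]
    by (intro C_k_on_mult C_k_on_powr C_k_on_subset[OF C_k_on_bump]) auto
  have psi0: "\<psi> s = 0" if "s \<le> 1 \<or> s \<ge> 2" for s using bump_eq_0[OF that] by (simp add: \<psi>_def)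
  let ?F = "\<lambda>x. \<psi> (K x) * (K x * det_variation (hess_half_square K x) (hess H x) -
      (real CARD('m) - 1) * (H x / K x) * det (hess_half_square K x))"
  let ?W = "\<lambda>x. weight (q / n) x * (K x * bump (K x))"
  have F: "integrable lborel ?F" "(\<integral>x. ?F x \<partial>lborel) = 0"
    using integral_gauge_identity[OF psi] psi0 by auto
  have W: "integrable lborel ?W"
    using C_k_on_imp_continuous_on[OF C_k_on_weight[of 0]]
    by (intro integrable_annular K.annular_bump_weight K.continuous_on_bump_weight) simp
  have "- real n * ?W x \<le> ?F x" for x
  proof (cases "x = 0")
    case False
    let ?r = "H x / K x" and ?d = "det (hess_half_square K x)"
    have Kp: "K x > 0" and r: "?r > 0" using K.pos[OF False] H.pos[OF False] by auto
    have "(?r powr q) powr (1 / n) = ?r powr (q / n)" by (simp add: powr_powr)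
    then have "det_variation (hess_half_square K x) (hess H x) \<ge> n / K x * ?r powr (q / n) * ?d"
      using det_variation_hess_ge[OF False n] rel[OF False] by simp
    then have "K x * det_variation (hess_half_square K x) (hess H x) \<ge> K x * (n / K x * ?r powr (q / n) * ?d)"
      using Kp by (intro mult_left_mono) auto
    also have "K x * (n / K x * ?r powr (q / n) * ?d) = n * ?r powr (q / n) * ?d" using Kp by simp
    finally have "n * ?r powr (q / n) * ?d - n * ?r * ?d \<le>
        K x * det_variation (hess_half_square K x) (hess H x) - (real CARD('m) - 1) * ?r * ?d"
      using n by simp
    moreover have "\<psi> (K x) \<ge> 0" by (simp add: \<psi>_def bump_nonneg)
    ultimately have "\<psi> (K x) * (n * ?r powr (q / n) * ?d - n * ?r * ?d) \<le> ?F x"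
      by (rule mult_left_mono)
    moreover have "\<psi> (K x) * (n * ?r powr (q / n) * ?d - n * ?r * ?d) = - real n * ?W x"
    proof -
      have "K x powr (- real CARD('m)) * K x = K x powr (- real n)"
        using Kp n by (simp add: powr_mult_base mult.commute)
      then have "\<psi> (K x) = K x powr (- real CARD('m)) * (K x * bump (K x))" by (simp add: \<psi>_def)
      then show ?thesis unfolding weight_def by (simp add: algebra_simps)
    qed
    ultimately show ?thesis by simp
  qed (simp add: K.zero psi0 bump_eq_0)
  then have "(\<integral>x. - real n * ?W x \<partial>lborel) \<le> (\<integral>x. ?F x \<partial>lborel)"
    using F W by (intro integral_mono integrable_mult_right) auto
  then have "real n * (\<integral>x. ?W x \<partial>lborel) \<ge> 0" using F(2) by simp
  then show ?thesis using n by (simp add: zero_le_mult_iff)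
qed

end

text \<open>Both factors have the sign of \<open>r - 1\<close>.\<close>

lemma powr_difference_product_nonneg:
  fixes r :: real
  assumes "r > 0" "p < q" "p < 1"
  shows "(r powr q - r powr p) * (r powr (1 - p) - 1) \<ge> 0"
    and "(r powr q - r powr p) * (r powr (1 - p) - 1) = 0 \<Longrightarrow> r = 1"
proof -
  have "(r > 1 \<and> r powr q > r powr p \<and> r powr (1 - p) > 1) \<or>
    (r < 1 \<and> r powr q < r powr p \<and> r powr (1 - p) < 1) \<or> r = 1"
  proof -
    consider "r > 1" | "r < 1" | "r = 1" by linarith
    then show ?thesis
    proof cases
      case 1
      then show ?thesis using assms powr_less_mono[of p q r] powr_less_mono[of 0 "1 - p" r] by simp
    next
      case 2
      then show ?thesis using assms powr_less_mono'[of r p q] powr_less_mono'[of r 0 "1 - p"] by simp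
    qed simp
  qed
  then show "(r powr q - r powr p) * (r powr (1 - p) - 1) \<ge> 0"
    "(r powr q - r powr p) * (r powr (1 - p) - 1) = 0 \<Longrightarrow> r = 1"
    by (auto simp: zero_le_mult_iff)
qed

text \<open>The hypothesis on the curvatures is preserved when \<open>H\<close> and \<open>K\<close> are exchanged, so the integrals of both
  weights are nonnegative; but the sum of the weights is nonpositive, hence zero.\<close>

theorem smooth_gauge_unique:
  fixes H K :: "real^'m \<Rightarrow> real" and q :: real
  assumes "smooth_gauge H" "smooth_gauge K"
    and n: "CARD('m) = n + 1" "n \<ge> 2" and q: "0 < q" "q < n"
    and rel: "\<And>x. x \<noteq> 0 \<Longrightarrow> smooth_gauge.curvature H x / smooth_gauge.curvature K x = (H x / K x) powr q"
  shows "H = K"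
proof -
  interpret HK: gauge_pair H K using assms by (simp add: gauge_pair_def)
  interpret KH: gauge_pair K H using assms by (simp add: gauge_pair_def)
  have rel': "HK.K.curvature x / HK.H.curvature x = (K x / H x) powr q" if "x \<noteq> 0" for x
  proof -
    have "HK.K.curvature x / HK.H.curvature x = inverse ((H x / K x) powr q)"
      using rel[OF that] by (metis inverse_divide)
    also have "\<dots> = (K x / H x) powr q"
      using HK.H.pos[OF that] HK.K.pos[OF that] by (simp add: powr_divide)
    finally show ?thesis .
  qed
  define p where "p = q / n"
  let ?wK = "\<lambda>x. K x * bump (K x)"
  have I: "(\<integral>x. HK.weight p x * ?wK x \<partial>lborel) \<ge> 0"
    using HK.weight_integral_nonneg[OF n(1) _ rel] n by (simp add: p_def)
  have II: "(\<integral>x. KH.weight p x * ?wK x \<partial>lborel) \<ge> 0"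
    using KH.weight_integral_nonneg[OF n(1) _ rel'] n
      integral_gauge_independent[OF assms(1,2) KH.C_k_on_weight[OF order_refl] KH.homogeneous_weight]
    by (simp add: p_def)
  let ?P = "\<lambda>x. - (HK.weight p x + KH.weight p x)"
  define c where "c x = K x powr (- real CARD('m)) * det (hess_half_square K x)" for x
  have P: "?P x = c x * (((H x / K x) powr q - (H x / K x) powr p) * ((H x / K x) powr (1 - p) - 1))"
    if x: "x \<noteq> 0" for x
  proof -
    let ?r = "H x / K x"
    have Hp: "H x > 0" and Kp: "K x > 0" using HK.H.pos[OF x] HK.K.pos[OF x] by auto
    define r where "r = ?r"
    have r: "r > 0" using Hp Kp by (simp add: r_def)
    have Hr: "H x = r * K x" using Kp by (simp add: r_def)
    have cK: "HK.K.curvature x > 0" by (rule HK.K.curvature_pos[OF x])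
    have cH: "HK.H.curvature x = r powr q * HK.K.curvature x"
      using rel[OF x] cK by (simp add: r_def field_simps)
    \<comment> \<open>The exponent collects \<open>2\<close> from the radial direction, \<open>n\<close> from the factor \<open>H\<close> in the tangential block
      and \<open>q\<close> from the hypothesis on the curvatures.\<close>
    have "det (hess_half_square H x) = r powr (real n + 2 + q) * det (hess_half_square K x)"
    proof -
      have "r powr (real n + 2 + q) = r ^ 2 * r ^ n * r powr q"
        using r by (simp add: powr_add powr_realpow)
      then show ?thesis
        unfolding HK.H.det_hess_half_square[OF x] HK.K.det_hess_half_square[OF x] cH
        using n by (simp add: Hr power_mult_distrib power_divide)
    qed
    moreover have "H x powr (- real CARD('m)) = r powr (- real n - 1) * K x powr (- real CARD('m))"
    proof -
      have "- real CARD('m) = - real n - 1" using n by simp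
      then show ?thesis using r Kp by (simp only: Hr powr_mult)
    qed
    ultimately have "H x powr (- real CARD('m)) * det (hess_half_square H x) =
        r powr (- real n - 1) * r powr (real n + 2 + q) * c x"
      by (simp add: c_def)
    also have "r powr (- real n - 1) * r powr (real n + 2 + q) = r powr (1 + q)"
      by (simp flip: powr_add)
    finally have "KH.weight p x = r powr (1 + q) * c x * (1 / r - (1 / r) powr p)"
      using Hp Kp by (simp add: KH.weight_def r_def)
    also have "\<dots> = c x * (r powr q - r powr (1 + q - p))"
      using r by (simp add: powr_divide powr_add powr_diff field_simps)
    finally have 2: "KH.weight p x = c x * (r powr q - r powr (1 + q - p))" .
    have 1: "HK.weight p x = c x * (r - r powr p)"
      by (simp add: HK.weight_def c_def r_def)
    have "(r powr q - r powr p) * (r powr (1 - p) - 1) = r powr (1 + q - p) - r powr q - r + r powr p"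
    proof -
      have "r powr q * r powr (1 - p) = r powr (1 + q - p)" "r powr p * r powr (1 - p) = r"
        using r by (simp_all flip: powr_add add: algebra_simps)
      then show ?thesis by (simp add: algebra_simps)
    qed
    then show ?thesis unfolding 1 2 r_def[symmetric] by (simp only:) (simp add: algebra_simps)
  qed
  have pq: "p < q" "p < 1" using n q by (auto simp: p_def divide_less_eq)
  have cpos: "c x > 0" if "x \<noteq> 0" for x
    unfolding c_def using HK.K.pos[OF that] HK.K.det_hess_half_square_pos[OF that] by simp
  let ?f = "\<lambda>x. ?P x * ?wK x"
  have cw: "continuous_on (- {0}) (HK.weight p)" "continuous_on (- {0}) (KH.weight p)"
    using HK.C_k_on_weight[of 0] KH.C_k_on_weight[of 0] by auto
  have cf: "continuous_on (- {0}) ?f"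
    by (rule HK.K.continuous_on_bump_weight) (intro continuous_intros cw)
  have af: "annular ?f" by (rule HK.K.annular_bump_weight)
  have int: "integrable lborel (\<lambda>x. HK.weight p x * ?wK x)" "integrable lborel (\<lambda>x. KH.weight p x * ?wK x)"
    by (intro integrable_annular HK.K.annular_bump_weight HK.K.continuous_on_bump_weight cw)+
  have f0: "?f x = 0" for x
  proof (rule continuous_nonneg_integral_nonpos_imp_zero[of ?f])
    obtain a where "a > 0" "\<And>x. norm x < a \<Longrightarrow> ?f x = 0"
      using af unfolding annular_def by blast
    then show "continuous_on UNIV ?f" using C_k_on_UNIV_annular[of 0 ?f a] cf by simp
    show "?f x \<ge> 0" for x
    proof (cases "x = 0")
      case False
      have "?P x \<ge> 0"
        unfolding P[OF False] using cpos[OF False] HK.H.pos[OF False] HK.K.pos[OF False]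
        by (intro mult_nonneg_nonneg powr_difference_product_nonneg(1) pq) auto
      then show ?thesis using HK.K.pos[OF False] bump_nonneg[of "K x"] by simp
    qed (simp add: HK.K.zero)
    show "integrable lborel ?f" by (rule integrable_annular[OF cf af])
    have "(\<integral>x. ?f x \<partial>lborel) = - (\<integral>x. HK.weight p x * ?wK x + KH.weight p x * ?wK x \<partial>lborel)"
      by (subst Bochner_Integration.integral_minus[symmetric]) (simp add: algebra_simps)
    also have "\<dots> = - ((\<integral>x. HK.weight p x * ?wK x \<partial>lborel) + (\<integral>x. KH.weight p x * ?wK x \<partial>lborel))"
      using int by (simp add: Bochner_Integration.integral_add)
    also have "\<dots> \<le> 0" using I II by simp
    finally show "(\<integral>x. ?f x \<partial>lborel) \<le> 0" .
  qed
  show "H = K"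
  proof
    fix x
    show "H x = K x"
    proof (cases "x = 0")
      case False
      \<comment> \<open>Scaling moves \<open>x\<close> to a point at which \<open>bump\<close> of the gauge is positive.\<close>
      define t where "t = 3 / 2 / K x"
      have t: "t > 0" using HK.K.pos[OF False] by (simp add: t_def)
      have tx: "t *\<^sub>R x \<noteq> 0" using t False by simp
      have Kt: "K (t *\<^sub>R x) = 3 / 2"
        using homogeneousD[OF HK.K.homog False t] t HK.K.pos[OF False] by (simp add: t_def)
      have "?P (t *\<^sub>R x) = 0"
        using f0[of "t *\<^sub>R x"] bump_pos[of "3 / 2"] unfolding Kt by simp
      then have "H (t *\<^sub>R x) / K (t *\<^sub>R x) = 1"
        unfolding P[OF tx] using cpos[OF tx] HK.H.pos[OF tx] HK.K.pos[OF tx]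
        by (intro powr_difference_product_nonneg(2)[OF _ pq]) (simp_all del: mult_eq_0_iff add: mult_eq_0_iff[of "c (t *\<^sub>R x)"])
      then show ?thesis using HK.ratio_scale[OF False t] HK.K.pos[OF False] by simp
    qed (simp add: HK.H.zero HK.K.zero)
  qed
qed

section \<open>Support functions on the sphere\<close>

lemma norm_has_derivative_tangent:
  assumes "norm (x :: 'a::real_inner) = 1"
  shows "(norm has_derivative (\<lambda>h. h \<bullet> x)) (at x)"
  using has_derivative_norm[of x] assms by (cases "x = 0") (auto simp: sgn_div_norm)

lemma sphere_deriv_eqI:
  fixes g G :: "'a::euclidean_space \<Rightarrow> 'b::real_normed_vector"
  assumes "norm x = 1" "(G has_derivative D) (at x)" "\<And>y. y \<noteq> 0 \<Longrightarrow> g (y /\<^sub>R norm y) = G y"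
  shows "sphere_deriv g x v = D v"
proof -
  have "((\<lambda>y. g (y /\<^sub>R norm y)) has_derivative D) (at x)"
    by (rule has_derivative_transform_within_open[OF assms(2), of "- {0}"]) (use assms in auto)
  then show ?thesis unfolding sphere_deriv_def by (simp flip: frechet_derivative_at)
qed

context smooth_homogeneous
begin

lemma has_derivative_H: "x \<noteq> 0 \<Longrightarrow> (H has_derivative (\<lambda>v. grad H x \<bullet> v)) (at x)"
  using has_derivative_pd[OF differentiable(1)] by (simp add: grad_def inner_vec_def mult.commute)

lemma has_derivative_grad: "x \<noteq> 0 \<Longrightarrow> (grad H has_derivative (\<lambda>v. hess H x *v v)) (at x)"
proof -
  assume x: "x \<noteq> 0"
  have "((\<lambda>y. \<Sum>i\<in>UNIV. pd i H y *\<^sub>R axis i (1::real)) has_derivative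
      (\<lambda>v. \<Sum>i\<in>UNIV. (\<Sum>j\<in>UNIV. v $ j * pd j (pd i H) x) *\<^sub>R axis i (1::real))) (at x)"
    by (intro has_derivative_sum has_derivative_scaleR_left has_derivative_pd differentiable x)
  moreover have "(\<lambda>y. \<Sum>i\<in>UNIV. pd i H y *\<^sub>R axis i 1) = grad H"
  proof
    show "(\<Sum>i\<in>UNIV. pd i H y *\<^sub>R axis i 1) = grad H y" for y
      using vec_basis_sum[of "grad H y"] by (simp add: grad_def)
  qed
  moreover have "(\<lambda>v. \<Sum>i\<in>UNIV. (\<Sum>j\<in>UNIV. v $ j * pd j (pd i H) x) *\<^sub>R axis i 1) = (*v) (hess H x)"
  proof
    show "(\<Sum>i\<in>UNIV. (\<Sum>j\<in>UNIV. v $ j * pd j (pd i H) x) *\<^sub>R axis i 1) = hess H x *v v" for v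
      using vec_basis_sum[of "hess H x *v v"] by (simp add: hess_def matrix_vector_mult_def mult.commute)
  qed
  ultimately show ?thesis by (simp only:)
qed

lemma restriction_scale: "y \<noteq> 0 \<Longrightarrow> H (y /\<^sub>R norm y) = H y / norm y"
  using homogeneousD[OF homog, of y "inverse (norm y)"] by (simp add: divide_inverse mult.commute)

lemma sphere_deriv_restriction:
  assumes x: "norm x = 1" and v: "v \<bullet> x = 0"
  shows "sphere_deriv H x v = grad H x \<bullet> v"
proof -
  have x0: "x \<noteq> 0" using x by auto
  have "((\<lambda>y. H y / norm y) has_derivative (\<lambda>h. (grad H x \<bullet> h * norm x - H x * (h \<bullet> x)) / (norm x * norm x))) (at x)"
    using x0 by (intro has_derivative_divide' has_derivative_H norm_has_derivative_tangent x) auto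
  from sphere_deriv_eqI[OF x this restriction_scale] show ?thesis using x v by simp
qed

lemma sphere_grad_restriction:
  assumes x: "norm x = 1"
  shows "sphere_grad H x = grad H x - H x *\<^sub>R x"
  unfolding sphere_grad_def
proof (rule the_equality)
  have xx: "x \<bullet> x = 1" using x by (simp add: norm_eq_1)
  have x0: "x \<noteq> 0" using x by auto
  show *: "grad H x - H x *\<^sub>R x \<in> tangent_space x \<and>
      (\<forall>v\<in>tangent_space x. (grad H x - H x *\<^sub>R x) \<bullet> v = sphere_deriv H x v)"
  proof -
    have "x \<bullet> v = 0" if "v \<in> tangent_space x" for v
      using that by (simp add: tangent_space_def inner_commute)
    then show ?thesis
      using grad_dot[OF x0] sphere_deriv_restriction[OF x]
      by (auto simp: tangent_space_def inner_diff_left xx)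
  qed
  fix g assume g: "g \<in> tangent_space x \<and> (\<forall>v\<in>tangent_space x. g \<bullet> v = sphere_deriv H x v)"
  let ?d = "g - (grad H x - H x *\<^sub>R x)"
  have "?d \<in> tangent_space x" using g * by (auto simp: tangent_space_def inner_diff_left)
  then have "?d \<bullet> ?d = 0" using g * by (subst inner_diff_left) simp
  then show "g = grad H x - H x *\<^sub>R x" by simp
qed

text \<open>On the unit sphere the intrinsic gradient is \<open>grad H x - H x x\<close>. Differentiating the second term in a
  tangent direction \<open>v\<close> contributes \<open>- H x v\<close> and a radial part, so the added multiple of the metric in
  \<open>hess_plus\<close> leaves exactly the ambient Hessian.\<close>

lemma hess_plus_restriction:
  assumes x: "norm x = 1" and v: "v \<bullet> x = 0" and w: "w \<bullet> x = 0"
  shows "hess_plus H x v w = v \<bullet> (hess H x *v w)"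
proof -
  have x0: "x \<noteq> 0" using x by auto
  have xx: "x \<bullet> x = 1" using x by (simp add: norm_eq_1)
  have g: "sphere_grad H (y /\<^sub>R norm y) = grad H y - (H y * inverse (y \<bullet> y)) *\<^sub>R y" if y: "y \<noteq> 0" for y
  proof -
    have "pd i H (y /\<^sub>R norm y) = pd i H y" for i
      using homogeneousD[OF homogeneous_pd[OF homog differentiable(1)] y, of "inverse (norm y)" i] y by simp
    then have "grad H (y /\<^sub>R norm y) = grad H y" by (simp add: grad_def)
    then show ?thesis
      using sphere_grad_restriction[of "y /\<^sub>R norm y"] restriction_scale[OF y] y
      by (simp add: dot_square_norm divide_inverse power2_eq_square)
  qed
  have "((\<lambda>y. inverse (y \<bullet> y)) has_derivative (\<lambda>h. - (inverse (x \<bullet> x) * (x \<bullet> h + h \<bullet> x) * inverse (x \<bullet> x)))) (at x)"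
    using x0 by (intro Deriv.has_derivative_inverse has_derivative_inner has_derivative_ident) auto
  then have "((\<lambda>y. grad H y - (H y * inverse (y \<bullet> y)) *\<^sub>R y) has_derivative
    (\<lambda>h. hess H x *v h - ((H x * inverse (x \<bullet> x)) *\<^sub>R h +
      (H x * (- (inverse (x \<bullet> x) * (x \<bullet> h + h \<bullet> x) * inverse (x \<bullet> x))) + (grad H x \<bullet> h) * inverse (x \<bullet> x)) *\<^sub>R x))) (at x)"
    by (intro has_derivative_diff has_derivative_grad has_derivative_scaleR has_derivative_mult has_derivative_H has_derivative_ident x0)
  from sphere_deriv_eqI[OF x this g]
  have "sphere_deriv (sphere_grad H) x v = hess H x *v v - (H x *\<^sub>R v + (grad H x \<bullet> v) *\<^sub>R x)"
    using v by (simp add: xx inner_commute)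
  then have "sphere_hessian H x v w = (hess H x *v v) \<bullet> w - H x * (v \<bullet> w)"
    using w by (simp add: sphere_hessian_def sphere_nabla_def inner_diff_left inner_add_left inner_commute[of x w])
  then show ?thesis
    using inner_matrix_sym[OF hess_sym[OF x0], of v w] by (simp add: hess_plus_def inner_commute)
qed

end

lemma frame_det_cong:
  fixes x :: "'a::euclidean_space"
  assumes x: "norm x = 1" and AB: "\<And>v w. v \<bullet> x = 0 \<Longrightarrow> w \<bullet> x = 0 \<Longrightarrow> A v w = B v w"
  shows "frame_det x A = frame_det x B"
proof -
  define e where "e = (SOME e. orthonormal_frame x e)"
  have "orthonormal_frame x e"
    using someI_ex[OF orthonormal_frame_exists[of x]] x by (simp add: e_def)
  then have "e i \<bullet> x = 0" if "i < DIM('a) - 1" for i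
    using that by (simp add: orthonormal_frame_def tangent_space_def)
  then have "frame_matrix e A = frame_matrix e B"
    by (intro eq_matI) (simp_all add: frame_matrix_def AB)
  then show ?thesis by (simp add: frame_det_def e_def)
qed

lemma sphere_deriv_cong:
  fixes g g' :: "'a::euclidean_space \<Rightarrow> 'b::real_normed_vector"
  assumes x: "norm x = 1" and eq: "\<And>y. norm y = 1 \<Longrightarrow> g y = g' y"
  shows "sphere_deriv g x v = sphere_deriv g' x v"
proof -
  have "g (y /\<^sub>R norm y) = g' (y /\<^sub>R norm y)" if "y \<noteq> 0" for y
    using that by (intro eq) simp
  moreover have "x \<noteq> 0" using x by auto
  ultimately have iff: "((\<lambda>y. g (y /\<^sub>R norm y)) has_derivative D) (at x) \<longleftrightarrow> ((\<lambda>y. g' (y /\<^sub>R norm y)) has_derivative D) (at x)" for D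
    using x has_derivative_transform_within_open[of "\<lambda>y. g (y /\<^sub>R norm y)" D x UNIV "- {0}" "\<lambda>y. g' (y /\<^sub>R norm y)"]
      has_derivative_transform_within_open[of "\<lambda>y. g' (y /\<^sub>R norm y)" D x UNIV "- {0}" "\<lambda>y. g (y /\<^sub>R norm y)"] open_punctured by auto
  then show ?thesis by (simp add: sphere_deriv_def frechet_derivative_def)
qed

lemma hess_plus_cong:
  fixes u u' :: "'a::euclidean_space \<Rightarrow> real"
  assumes x: "norm x = 1" and eq: "\<And>y. norm y = 1 \<Longrightarrow> u y = u' y"
  shows "hess_plus u x v w = hess_plus u' x v w"
proof -
  have "sphere_grad u y = sphere_grad u' y" if "norm y = 1" for y
    using sphere_deriv_cong[OF that eq] by (simp add: sphere_grad_def)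
  then have "sphere_deriv (sphere_grad u) x v = sphere_deriv (sphere_grad u') x v"
    by (rule sphere_deriv_cong[OF x])
  then show ?thesis using eq[OF x] by (simp add: hess_plus_def sphere_hessian_def sphere_nabla_def)
qed

definition radial_extension :: "('a::real_normed_vector \<Rightarrow> real) \<Rightarrow> 'a \<Rightarrow> real" where
  "radial_extension u x = norm x * u (x /\<^sub>R norm x)"

lemma radial_extension_unit: "norm x = 1 \<Longrightarrow> radial_extension u x = u x"
  by (simp add: radial_extension_def)

lemma smooth_homogeneous_radial_extension:
  fixes u :: "real^'m \<Rightarrow> real"
  assumes "smooth_on u (sphere 0 1)"
  shows "smooth_homogeneous (radial_extension u)"
proof
  show "C_k_on 3 (radial_extension u) (- {0})"
    using C_k_on_radial_extension[OF assms] unfolding radial_extension_def[abs_def] .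
  show "homogeneous 1 (radial_extension u)"
    unfolding homogeneous_def
  proof (intro allI impI)
    fix x :: "real^'m" and t :: real assume "x \<noteq> 0" "t > 0"
    then have e: "(t *\<^sub>R x) /\<^sub>R norm (t *\<^sub>R x) = x /\<^sub>R norm x" by (simp add: field_simps)
    then show "radial_extension u (t *\<^sub>R x) = t powr 1 * radial_extension u x"
      unfolding radial_extension_def e using \<open>t > 0\<close> by simp
  qed
qed

lemma smooth_gauge_radial_extension:
  fixes u :: "real^'m \<Rightarrow> real"
  assumes sm: "smooth_on u (sphere 0 1)" and pos: "\<And>x. norm x = 1 \<Longrightarrow> u x > 0"
    and cv: "\<And>x v. norm x = 1 \<Longrightarrow> v \<bullet> x = 0 \<Longrightarrow> v \<noteq> 0 \<Longrightarrow> hess_plus u x v v > 0"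
  shows "smooth_gauge (radial_extension u)"
proof -
  let ?H = "radial_extension u"
  interpret smooth_homogeneous ?H by (rule smooth_homogeneous_radial_extension[OF sm])
  show ?thesis
  proof
    show "?H 0 = 0" by (simp add: radial_extension_def)
    show "?H x > 0" if "x \<noteq> 0" for x using that pos[of "x /\<^sub>R norm x"] by (simp add: radial_extension_def)
    show "v \<bullet> (hess ?H x *v v) > 0" if x: "x \<noteq> 0" and v: "v \<noteq> 0" "v \<bullet> x = 0" for x v
    proof -
      let ?e = "x /\<^sub>R norm x"
      have e: "norm ?e = 1" "v \<bullet> ?e = 0" using x v by simp_all
      have "0 < hess_plus u ?e v v" by (rule cv[OF e v(1)])
      also have "\<dots> = hess_plus ?H ?e v v"
        by (rule hess_plus_cong[OF e(1)]) (simp add: radial_extension_unit)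
      also have "\<dots> = v \<bullet> (hess ?H ?e *v v)" by (rule hess_plus_restriction[OF e e(2)])
      also have "hess ?H ?e = norm x *\<^sub>R hess ?H x" by (rule hess_at_unit[OF x])
      finally show ?thesis using x by (simp add: scaleR_matrix_vector_assoc[symmetric] zero_less_mult_iff)
    qed
  qed
qed

lemma curvature_radial_extension:
  fixes u :: "real^'m \<Rightarrow> real"
  assumes "smooth_gauge (radial_extension u)" and x: "x \<noteq> 0"
  shows "smooth_gauge.curvature (radial_extension u) x = sigma_n u (x /\<^sub>R norm x) / norm x ^ (CARD('m) - 1)"
proof -
  let ?H = "radial_extension u"
  interpret smooth_gauge ?H by fact
  let ?e = "x /\<^sub>R norm x"
  have e: "norm ?e = 1" using x by simp
  have "hess ?H x = (1 / norm x) *\<^sub>R hess ?H ?e"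
    using x by (simp add: hess_at_unit)
  then have "(\<lambda>v w. v \<bullet> (hess ?H x *v w)) = (\<lambda>v w. (1 / norm x) * (v \<bullet> (hess ?H ?e *v w)))"
    by (simp add: scaleR_matrix_vector_assoc[symmetric])
  then have "curvature x = (1 / norm x) ^ (CARD('m) - 1) * frame_det ?e (\<lambda>v w. v \<bullet> (hess ?H ?e *v w))"
    unfolding curvature_def by (simp only: frame_det_scale) simp
  also have "frame_det ?e (\<lambda>v w. v \<bullet> (hess ?H ?e *v w)) = frame_det ?e (hess_plus u ?e)"
  proof (rule frame_det_cong[OF e])
    fix v w assume vw: "v \<bullet> ?e = 0" "w \<bullet> ?e = 0"
    have "hess_plus ?H ?e v w = hess_plus u ?e v w"
      by (rule hess_plus_cong[OF e]) (rule radial_extension_unit)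
    then show "v \<bullet> (hess ?H ?e *v w) = hess_plus u ?e v w"
      unfolding hess_plus_restriction[OF e vw] .
  qed
  finally show ?thesis by (simp add: sigma_n_def power_divide)
qed

theorem proposition4p1:
  fixes n :: nat and \<alpha> \<beta> c :: real and f u1 u2 :: "real ^ 'm \<Rightarrow> real"
  assumes "CARD('m) = n + 1" and "n \<ge> 2"
    and "\<beta> > 0" and "1 < \<alpha>" and "\<alpha> < 1 + real n * \<beta>"
    and "smooth_on f (sphere 0 1)" and "\<forall>x\<in>sphere 0 1. f x > 0"
    and "c > 0"
    and "smooth_solution f \<alpha> \<beta> c u1" and "smooth_solution f \<alpha> \<beta> c u2"
  shows "\<forall>x\<in>sphere 0 1. u1 x = u2 x"
proof -
  let ?H = "radial_extension u1" and ?K = "radial_extension u2"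
  have gauge: "smooth_gauge (radial_extension u)" if "smooth_solution f \<alpha> \<beta> c u" for u
    using that by (intro smooth_gauge_radial_extension) (auto simp: smooth_solution_def tangent_space_def)
  have H: "smooth_gauge ?H" and K: "smooth_gauge ?K" using gauge assms(9,10) by auto
  let ?q = "(\<alpha> - 1) / \<beta>"
  have "?H = ?K"
  proof (rule smooth_gauge_unique[OF H K assms(1,2)])
    show "0 < ?q" "?q < real n" using assms(3-5) by (simp_all add: divide_less_eq)
    fix x :: "real^'m" assume x: "x \<noteq> 0"
    define e where "e = x /\<^sub>R norm x"
    have e: "e \<in> sphere 0 1" using x by (simp add: e_def)
    let ?s1 = "sigma_n u1 e" and ?s2 = "sigma_n u2 e"
    have p: "u1 e > 0" "u2 e > 0" "f e > 0"
      using e assms(7,9,10) by (auto simp: smooth_solution_def)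
    have s: "?s1 > 0" "?s2 > 0"
      using smooth_gauge.curvature_pos[OF H x] smooth_gauge.curvature_pos[OF K x] x
      by (simp_all add: curvature_radial_extension[OF H x] curvature_radial_extension[OF K x] e_def zero_less_divide_iff)
    have "f e * u1 e powr (\<alpha> - 1) * ?s1 powr (- \<beta>) = f e * u2 e powr (\<alpha> - 1) * ?s2 powr (- \<beta>)"
      using e assms(9,10) by (auto simp: smooth_solution_def)
    then have "u1 e powr (\<alpha> - 1) / ?s1 powr \<beta> = u2 e powr (\<alpha> - 1) / ?s2 powr \<beta>"
      using p(3) unfolding powr_minus_divide mult.assoc mult_cancel_left by simp
    then have "?s1 powr \<beta> / ?s2 powr \<beta> = u1 e powr (\<alpha> - 1) / u2 e powr (\<alpha> - 1)"
      using p s by (simp add: frac_eq_eq mult.commute)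
    then have E: "(?s1 / ?s2) powr \<beta> = (u1 e / u2 e) powr (\<alpha> - 1)"
      unfolding powr_divide .
    have "?s1 / ?s2 = ((?s1 / ?s2) powr \<beta>) powr (1 / \<beta>)"
      using s assms(3) unfolding powr_powr by (simp add: abs_of_pos)
    also have "\<dots> = (u1 e / u2 e) powr ?q"
      unfolding E powr_powr by simp
    finally have "?s1 / ?s2 = (u1 e / u2 e) powr ?q" .
    moreover have "?H x / ?K x = u1 e / u2 e"
      unfolding radial_extension_def e_def[symmetric] using x by simp
    moreover have "smooth_gauge.curvature ?H x / smooth_gauge.curvature ?K x = ?s1 / ?s2"
      unfolding curvature_radial_extension[OF H x] curvature_radial_extension[OF K x] e_def[symmetric]
      using x by simp
    ultimately show "smooth_gauge.curvature ?H x / smooth_gauge.curvature ?K x = (?H x / ?K x) powr ?q"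
      by (simp only:)
  qed
  then show ?thesis by (metis mem_sphere_0 radial_extension_unit)
qed

end
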